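(* Let $K$ be a reduced commutative ring with $\frac12\in K$. Then: 1. The group $U=\Omega\rtimes\Gamma$ is the semi-direct product of its subgroups ($\Omega$ is a normal subgroup of $U$, $\Omega\cap\Gamma=\{e\}$, and $U=\Omega\Gamma$). 2. $G=U\rtimes\mathrm{GL}_n(K)^{op}$ ($U$ is a normal subgroup of $G$, $U\cap\mathrm{GL}_n(K)^{op}=\{e\}$, and $G=U\,\mathrm{GL}_n(K)^{op}$). 3. $G=(\Omega\rtimes\Gamma)\rtimes\mathrm{GL}_n(K)^{op}$.
   Context: $\Lambda_n=\Lambda_n(K)$ is the Grassmann $K$-algebra generated freely over $K$ by $x_1,\dots,x_n$ subject to $x_i^2=0$, $x_ix_j=-x_jx_i$ ($i\ne j$); it is graded by total degree with components $\Lambda_{n,d}$; $\mathfrak m=\bigoplus_{d\ge1}\Lambda_{n,d}$; $\Lambda_n^{od}$ is the sum of the odd degree components. A commutative ring is reduced if $0$ is its only nilpotent element. $G=\mathrm{Aut}_K(\Lambda_n)$ is the group of $K$-algebra automorphisms of $\Lambda_n$. $U=\{\sigma\in G\mid\sigma(x_i)-x_i\in\mathfrak m^2\text{ for all }i\}$. $\Gamma=\{\sigma\in G\mid\sigma(x_i)-x_i\in\Lambda_n^{od}\cap\mathfrak m^3\text{ for all }i\}$. For a unit $u\in\Lambda_n$, $\omega_u(x)=uxu^{-1}$, and $\Omega=\{\omega_{1+a}\mid a\in\Lambda_n^{od}\}$. $\mathrm{GL}_n(K)^{op}$ denotes the subgroup $\{\sigma_A\mid A\in\mathrm{GL}_n(K)\}$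 of $G$, where $\sigma_A(x_i)=\sum_{j=1}^na_{ij}x_j$ for $A=(a_{ij})$ (note $\sigma_A\sigma_B=\sigma_{BA}$). *)

theory Defs
  imports "HOL-Analysis.Analysis" "HOL-Algebra.Coset"
begin

locale algebra_over = module scale
  for scale :: "'k::comm_ring_1 \<Rightarrow> 'a::ring_1 \<Rightarrow> 'a" +
  assumes scale_mult_left: "scale c (x * y) = scale c x * y"
    and scale_mult_right: "scale c (x * y) = x * scale c y"

definition alg_hom ::
  "('k::comm_ring_1 \<Rightarrow> 'a::ring_1 \<Rightarrow> 'a) \<Rightarrow> ('k \<Rightarrow> 'b::ring_1 \<Rightarrow> 'b) \<Rightarrow> ('a \<Rightarrow> 'b) \<Rightarrow> bool" where
  "alg_hom s t f \<longleftrightarrow> module_hom s t f \<and> f 1 = 1 \<and> (\<forall>x y. f (x * y) = f x * f y)"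

definition alg_Aut :: "('k::comm_ring_1 \<Rightarrow> 'a::ring_1 \<Rightarrow> 'a) \<Rightarrow> ('a \<Rightarrow> 'a) monoid" where
  "alg_Aut s = \<lparr>carrier = {f. alg_hom s s f \<and> bij f}, monoid.mult = (\<circ>), one = id\<rparr>"

definition ring_inv :: "'a::ring_1 \<Rightarrow> 'a" where
  "ring_inv u = (THE v. u * v = 1 \<and> v * u = 1)"

definition inner_aut :: "'a::ring_1 \<Rightarrow> 'a \<Rightarrow> 'a" where
  "inner_aut u = (\<lambda>x. u * x * ring_inv u)"

definition semidirect :: "('a, 'b) monoid_scheme \<Rightarrow> 'a set \<Rightarrow> 'a set \<Rightarrow> bool" where
  "semidirect G N H \<longleftrightarrow>
     N \<lhd> G \<and> subgroup H G \<and> N \<inter> H = {\<one>\<^bsub>G\<^esub>} \<and> N <#>\<^bsub>G\<^esub> H = carrier G"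

text \<open>
  The generators are indexed by a finite linearly ordered type \<open>'n\<close> with \<open>n\<close> elements; the order
  only serves to fix the signs. An element
  is given by its coefficients with respect to the monomials \<open>x\<^sub>S = x\<^sub>i\<^sub>1 \<cdots> x\<^sub>i\<^sub>k\<close>, where
  \<open>S = {i\<^sub>1 < \<dots> < i\<^sub>k}\<close> ranges over all subsets of \<open>'n\<close>. That this is the algebra freely generated
  by the \<open>x\<^sub>i\<close> subject to \<open>x\<^sub>i\<^sup>2 = 0\<close> and \<open>x\<^sub>i x\<^sub>j = -x\<^sub>j x\<^sub>i\<close> is the content of
  \<open>gen_square\<close>, \<open>gen_anticommute\<close> and \<open>grassmann_universal\<close> below.
\<close>

typedef ('k, 'n) grassmann = "UNIV :: ('n set \<Rightarrow> 'k) set"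
  morphisms gcoeff Grassmann by simp

lemmas gcoeff_Grassmann [simp] = Grassmann_inverse [OF UNIV_I]

lemma grassmann_eqI: "(\<And>S. gcoeff f S = gcoeff g S) \<Longrightarrow> f = g"
  by (simp add: gcoeff_inject [symmetric] ext)

text \<open>
  For disjoint \<open>S\<close> and \<open>T\<close> one has \<open>x\<^sub>S x\<^sub>T = \<plusminus>x\<^bsub>S \<union> T\<^esub>\<close>, the sign counting the inversions.
\<close>

definition shuffle_sign :: "'n::linorder set \<Rightarrow> 'n set \<Rightarrow> 'k::comm_ring_1" where
  "shuffle_sign S T = (- 1) ^ card {(i, j). i \<in> S \<and> j \<in> T \<and> j < i}"

lemma shuffle_sign_empty [simp]: "shuffle_sign {} T = 1" "shuffle_sign S {} = 1"
  by (simp_all add: shuffle_sign_def)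

lemma shuffle_sign_Un_left:
  fixes A B C :: "'n::{finite,linorder} set"
  assumes "A \<inter> B = {}"
  shows "shuffle_sign (A \<union> B) C = shuffle_sign A C * (shuffle_sign B C :: 'k::comm_ring_1)"
proof -
  have "{(i, j). i \<in> A \<union> B \<and> j \<in> C \<and> j < i} =
      {(i, j). i \<in> A \<and> j \<in> C \<and> j < i} \<union> {(i, j). i \<in> B \<and> j \<in> C \<and> j < i}"
    by auto
  moreover have "{(i, j). i \<in> A \<and> j \<in> C \<and> j < i} \<inter> {(i, j). i \<in> B \<and> j \<in> C \<and> j < i} = {}"
    using assms by auto
  ultimately show ?thesis
    by (simp add: shuffle_sign_def card_Un_disjoint power_add)
qed

lemma shuffle_sign_Un_right:
  fixes A B C :: "'n::{finite,linorder} set"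
  assumes "B \<inter> C = {}"
  shows "shuffle_sign A (B \<union> C) = shuffle_sign A B * (shuffle_sign A C :: 'k::comm_ring_1)"
proof -
  have "{(i, j). i \<in> A \<and> j \<in> B \<union> C \<and> j < i} =
      {(i, j). i \<in> A \<and> j \<in> B \<and> j < i} \<union> {(i, j). i \<in> A \<and> j \<in> C \<and> j < i}"
    by auto
  moreover have "{(i, j). i \<in> A \<and> j \<in> B \<and> j < i} \<inter> {(i, j). i \<in> A \<and> j \<in> C \<and> j < i} = {}"
    using assms by auto
  ultimately show ?thesis
    by (simp add: shuffle_sign_def card_Un_disjoint power_add)
qed

instantiation grassmann :: (comm_ring_1, "{finite,linorder}") ring_1
begin

definition "0 = Grassmann (\<lambda>_. 0)"
definition "1 = Grassmann (\<lambda>S. if S = {} then 1 else 0)"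
definition "f + g = Grassmann (\<lambda>S. gcoeff f S + gcoeff g S)"
definition "- f = Grassmann (\<lambda>S. - gcoeff f S)"
definition "f - g = Grassmann (\<lambda>S. gcoeff f S - gcoeff g S)"
definition "f * g = Grassmann (\<lambda>U. \<Sum>S\<in>Pow U. shuffle_sign S (U - S) * gcoeff f S * gcoeff g (U - S))"

lemma gcoeff_simps [simp]:
  "gcoeff 0 S = 0"
  "gcoeff 1 S = (if S = {} then 1 else 0)"
  "gcoeff (f + g) S = gcoeff f S + gcoeff g S"
  "gcoeff (- f) S = - gcoeff f S"
  "gcoeff (f - g) S = gcoeff f S - gcoeff g S"
  by (simp_all add: zero_grassmann_def one_grassmann_def plus_grassmann_def uminus_grassmann_def
      minus_grassmann_def)

lemma gcoeff_mult:
  "gcoeff (f * g) U = (\<Sum>S\<in>Pow U. shuffle_sign S (U - S) * gcoeff f S * gcoeff g (U - S))"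
  by (simp add: times_grassmann_def)

instance
proof
  fix a b c :: "('a, 'b) grassmann"
  show "a * b * c = a * (b * c)"
  proof (rule grassmann_eqI)
    fix U
    define F where "F P A = shuffle_sign P (U - P) * (shuffle_sign A (P - A) * gcoeff a A *
      gcoeff b (P - A)) * gcoeff c (U - P)" for P A
    define H where "H A B = shuffle_sign A (U - A) * gcoeff a A * (shuffle_sign B (U - A - B) *
      gcoeff b B * gcoeff c (U - A - B))" for A B
    have "gcoeff (a * b * c) U = (\<Sum>P\<in>Pow U. \<Sum>A\<in>Pow P. F P A)"
      by (simp add: gcoeff_mult F_def sum_distrib_left sum_distrib_right)
    also have "\<dots> = (\<Sum>(P, A)\<in>(SIGMA P:Pow U. Pow P). F P A)"
      by (rule sum.Sigma) auto
    also have "\<dots> = (\<Sum>(A, B)\<in>(SIGMA A:Pow U. Pow (U - A)). H A B)"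
    proof (rule sum.reindex_bij_witness [where i = "\<lambda>(A, B). (A \<union> B, A)" and j = "\<lambda>(P, A). (A, P - A)"])
      fix x assume x: "x \<in> (SIGMA P:Pow U. Pow P)"
      obtain P A where [simp]: "x = (P, A)" by (cases x)
      define B where "B = P - A"
      define C where "C = U - P"
      have eq: "P = A \<union> B" "P - A = B" "U - P = C" "U - A = B \<union> C" "(B \<union> C) - B = C"
        and disj: "A \<inter> B = {}" "B \<inter> C = {}"
        using x by (auto simp: B_def C_def)
      have "F P A = H A B"
        unfolding F_def H_def eq(2-5)
        unfolding eq(1) shuffle_sign_Un_left [OF disj(1)] shuffle_sign_Un_right [OF disj(2)]
        by (simp add: mult_ac)
      then show "(case case x of (P, A) \<Rightarrow> (A, P - A) of (A, B) \<Rightarrow> H A B) =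
          (case x of (P, A) \<Rightarrow> F P A)"
        by (simp add: B_def)
    qed auto
    also have "\<dots> = (\<Sum>A\<in>Pow U. \<Sum>B\<in>Pow (U - A). H A B)"
      by (rule sum.Sigma [symmetric]) auto
    also have "\<dots> = gcoeff (a * (b * c)) U"
      by (simp add: gcoeff_mult H_def sum_distrib_left)
    finally show "gcoeff (a * b * c) U = gcoeff (a * (b * c)) U" .
  qed
  show "1 * a = a"
  proof (rule grassmann_eqI)
    fix U :: "'b set"
    have "gcoeff (1 * a) U = (\<Sum>S\<in>Pow U. if S = {} then gcoeff a U else 0)"
      unfolding gcoeff_mult by (rule sum.cong) auto
    then show "gcoeff (1 * a) U = gcoeff a U"
      by simp
  qed
  show "a * 1 = a"
  proof (rule grassmann_eqI)
    fix U :: "'b set"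
    have "gcoeff (a * 1) U = (\<Sum>S\<in>Pow U. if S = U then gcoeff a U else 0)"
      unfolding gcoeff_mult by (rule sum.cong) auto
    then show "gcoeff (a * 1) U = gcoeff a U"
      by simp
  qed
  show "(0::('a, 'b) grassmann) \<noteq> 1"
  proof
    assume "(0::('a, 'b) grassmann) = 1"
    then have "gcoeff (0::('a, 'b) grassmann) {} = gcoeff 1 {}" by simp
    then show False by simp
  qed
qed (auto intro!: grassmann_eqI simp: gcoeff_mult algebra_simps sum.distrib)

end

lemma gcoeff_sum: "gcoeff (\<Sum>i\<in>I. f i) S = (\<Sum>i\<in>I. gcoeff (f i) S)"
  by (induction I rule: infinite_finite_induct) auto

definition gscale :: "'k::comm_ring_1 \<Rightarrow> ('k, 'n::{finite,linorder}) grassmann \<Rightarrow> ('k, 'n) grassmann" where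
  "gscale c f = Grassmann (\<lambda>S. c * gcoeff f S)"

lemma gcoeff_gscale [simp]: "gcoeff (gscale c f) S = c * gcoeff f S"
  by (simp add: gscale_def)

interpretation grassmann: algebra_over "gscale :: 'k::comm_ring_1 \<Rightarrow> ('k, 'n::{finite,linorder}) grassmann \<Rightarrow> _"
  by unfold_locales (auto intro!: grassmann_eqI simp: gcoeff_mult algebra_simps sum_distrib_left)

definition gen :: "'n::{finite,linorder} \<Rightarrow> ('k::comm_ring_1, 'n) grassmann" where
  "gen i = Grassmann (\<lambda>S. if S = {i} then 1 else 0)"

lemma gcoeff_gen: "gcoeff (gen i) S = (if S = {i} then 1 else 0)"
  by (simp add: gen_def)

definition ordered_prod :: "('n::{finite,linorder} \<Rightarrow> 'a::ring_1) \<Rightarrow> 'n set \<Rightarrow> 'a" where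
  "ordered_prod y S = prod_list (map y (sorted_list_of_set S))"

lemma ordered_prod_empty [simp]: "ordered_prod y {} = 1"
  by (simp add: ordered_prod_def)

lemma ordered_prod_singleton [simp]: "ordered_prod y {i} = y i"
  by (simp add: ordered_prod_def)

lemma ordered_prod_insert_min:
  assumes "\<forall>a\<in>A. b < a"
  shows "ordered_prod y (insert b A) = y b * ordered_prod y A"
proof -
  have "sorted_list_of_set (insert b A) = insort b (sorted_list_of_set A)"
    using assms by (subst sorted_list_of_set_insert) auto
  also have "\<dots> = b # sorted_list_of_set A"
    using assms by (intro insort_is_Cons) auto
  finally show ?thesis by (simp add: ordered_prod_def)
qed

text \<open>The substitution \<open>x\<^sub>i \<mapsto> y\<^sub>i\<close>; it is an algebra homomorphism as soon as the \<open>y\<^sub>i\<close> satisfy the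
  defining relations.\<close>

definition subst_hom ::
  "('k \<Rightarrow> 'a::ring_1 \<Rightarrow> 'a) \<Rightarrow> ('n \<Rightarrow> 'a) \<Rightarrow> ('k::comm_ring_1, 'n::{finite,linorder}) grassmann \<Rightarrow> 'a" where
  "subst_hom s y f = (\<Sum>S\<in>UNIV. s (gcoeff f S) (ordered_prod y S))"

lemma gcoeff_gen_mult:
  "gcoeff (gen i * f) U = (if i \<in> U then shuffle_sign {i} (U - {i}) * gcoeff f (U - {i}) else 0)"
proof -
  have "gcoeff (gen i * f) U =
      (\<Sum>S\<in>Pow U. if S = {i} then shuffle_sign {i} (U - {i}) * gcoeff f (U - {i}) else 0)"
    unfolding gcoeff_mult by (rule sum.cong) (auto simp: gcoeff_gen)
  then show ?thesis by simp
qed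

lemma gcoeff_ordered_prod_gen:
  "gcoeff (ordered_prod gen S :: ('k::comm_ring_1, 'n::{finite,linorder}) grassmann) T = (if T = S then 1 else 0)"
proof -
  have "finite S" by simp
  then show ?thesis
  proof (induction S arbitrary: T rule: finite_linorder_min_induct)
    case (insert b A)
    have "{(i, j). i \<in> {b} \<and> j \<in> A \<and> j < i} = {}"
      using insert.hyps by auto
    then have "shuffle_sign {b} A = (1::'k)"
      unfolding shuffle_sign_def by (simp only: card.empty power_0)
    moreover have "b \<notin> A" using insert.hyps by auto
    ultimately show ?case
      using insert by (auto simp: ordered_prod_insert_min gcoeff_gen_mult)
  qed simp
qed

lemma grassmann_expansion: "f = (\<Sum>S\<in>UNIV. gscale (gcoeff f S) (ordered_prod gen S))"
  by (rule grassmann_eqI) (simp add: gcoeff_sum gcoeff_ordered_prod_gen if_distrib cong: if_cong)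

lemma gen_square: "gen i * gen i = 0"
  by (rule grassmann_eqI) (auto simp: gcoeff_gen_mult gcoeff_gen)

context algebra_over
begin

lemma gen_mult_ordered_prod:
  fixes y :: "'n::{finite,linorder} \<Rightarrow> 'a"
  assumes sq: "\<And>i. y i * y i = 0"
    and anti: "\<And>i j. i \<noteq> j \<Longrightarrow> y i * y j = - (y j * y i)"
  shows "y i * ordered_prod y T =
    (if i \<in> T then 0 else scale (shuffle_sign {i} T) (ordered_prod y (insert i T)))"
proof -
  have "finite T" by simp
  then show ?thesis
  proof (induction T rule: finite_linorder_min_induct)
    case empty
    then show ?case by simp
  next
    case (insert b A)
    have bA: "b \<notin> A" using insert.hyps by auto
    have split: "shuffle_sign {i} (insert b A) = (shuffle_sign {i} {b} * shuffle_sign {i} A :: 'k)"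
      using shuffle_sign_Un_right [of "{b}" A "{i}"] bA by simp
    have fst: "ordered_prod y (insert b A) = y b * ordered_prod y A"
      using insert.hyps by (simp add: ordered_prod_insert_min)
    consider "i = b" | "i < b" | "b < i" by fastforce
    then show ?case
    proof cases
      case 1
      then show ?thesis using sq by (simp add: fst mult.assoc [symmetric])
    next
      case 2
      then have "\<forall>a\<in>insert b A. i < a" using insert.hyps by auto
      moreover from this have "{(k, j). k \<in> {i} \<and> j \<in> insert b A \<and> j < k} = {}"
        by (auto dest: less_asym)
      then have "shuffle_sign {i} (insert b A) = (1::'k)"
        unfolding shuffle_sign_def by (simp only: card.empty power_0)
      moreover have "i \<notin> insert b A" using calculation by auto
      ultimately show ?thesis
        by (simp add: ordered_prod_insert_min)
    next
      case 3
      have "{(k, j). k \<in> {i} \<and> j \<in> {b} \<and> j < k} = {(i, b)}"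
        using 3 by auto
      then have s: "shuffle_sign {i} {b} = (- 1 :: 'k)"
        unfolding shuffle_sign_def by (simp only:) simp
      have "y i * ordered_prod y (insert b A) = - (y b * (y i * ordered_prod y A))"
        using 3 by (simp add: fst anti [of i b] mult.assoc [symmetric])
      also have "\<dots> = (if i \<in> insert b A then 0 else
          scale (shuffle_sign {i} (insert b A)) (y b * ordered_prod y (insert i A)))"
        using insert.IH 3 less_imp_neq [OF 3] by (auto simp: split s scale_mult_right [symmetric])
      also have "y b * ordered_prod y (insert i A) = ordered_prod y (insert b (insert i A))"
        using 3 insert.hyps by (subst ordered_prod_insert_min) auto
      finally show ?thesis by (simp add: insert_commute)
    qed
  qed
qed

lemma ordered_prod_mult:
  fixes y :: "'n::{finite,linorder} \<Rightarrow> 'a"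
  assumes sq: "\<And>i. y i * y i = 0"
    and anti: "\<And>i j. i \<noteq> j \<Longrightarrow> y i * y j = - (y j * y i)"
  shows "ordered_prod y S * ordered_prod y T =
    (if S \<inter> T = {} then scale (shuffle_sign S T) (ordered_prod y (S \<union> T)) else 0)"
proof -
  have "finite S" by simp
  then show ?thesis
  proof (induction S rule: finite_linorder_min_induct)
    case empty
    then show ?case by simp
  next
    case (insert b A)
    have bA: "b \<notin> A" using insert.hyps by auto
    have "{(k, j). k \<in> {b} \<and> j \<in> A \<and> j < k} = {}"
      using insert.hyps by auto
    then have s1: "shuffle_sign {b} A = (1::'k)"
      unfolding shuffle_sign_def by (simp only: card.empty power_0)
    have s2: "shuffle_sign (insert b A) T = (shuffle_sign {b} T * shuffle_sign A T :: 'k)"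
      using shuffle_sign_Un_left [of "{b}" A T] bA by simp
    have "ordered_prod y (insert b A) * ordered_prod y T =
        y b * (ordered_prod y A * ordered_prod y T)"
      using insert.hyps by (simp add: ordered_prod_insert_min mult.assoc)
    also have "\<dots> = (if A \<inter> T = {} then
        scale (shuffle_sign A T) (y b * ordered_prod y (A \<union> T)) else 0)"
      by (simp add: insert.IH scale_mult_right)
    also have "\<dots> = (if insert b A \<inter> T = {} then
        scale (shuffle_sign (insert b A) T) (ordered_prod y (insert b A \<union> T)) else 0)"
      using bA s1 by (auto simp: gen_mult_ordered_prod [of y, OF sq anti] s2 shuffle_sign_Un_right mult.commute)
    finally show ?case .
  qed
qed

theorem alg_hom_subst_hom:
  fixes y :: "'n::{finite,linorder} \<Rightarrow> 'a"
  assumes sq: "\<And>i. y i * y i = 0"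
    and anti: "\<And>i j. i \<noteq> j \<Longrightarrow> y i * y j = - (y j * y i)"
  shows "alg_hom gscale scale (subst_hom scale y)"
proof -
  let ?p = "ordered_prod y"
  have mult: "subst_hom scale y (f * g) = subst_hom scale y f * subst_hom scale y g"
    for f g :: "('k, 'n) grassmann"
  proof -
    define H where "H S T = scale (gcoeff f S * gcoeff g T * shuffle_sign S T) (?p (S \<union> T))" for S T
    have "subst_hom scale y (f * g) = (\<Sum>U\<in>UNIV. \<Sum>S\<in>Pow U. H S (U - S))"
      unfolding subst_hom_def gcoeff_mult scale_sum_left
      by (intro sum.cong) (auto simp: H_def Un_absorb1 algebra_simps)
    also have "\<dots> = (\<Sum>(U, S)\<in>(SIGMA U:UNIV. Pow U). H S (U - S))"
      by (rule sum.Sigma) auto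
    also have "\<dots> = (\<Sum>(S, T)\<in>(SIGMA S:UNIV. {T. S \<inter> T = {}}). H S T)"
      by (rule sum.reindex_bij_witness [where i = "\<lambda>(S, T). (S \<union> T, S)" and j = "\<lambda>(U, S). (S, U - S)"]) auto
    also have "\<dots> = (\<Sum>S\<in>UNIV. \<Sum>T\<in>{T. S \<inter> T = {}}. H S T)"
      by (rule sum.Sigma [symmetric]) auto
    also have "\<dots> = (\<Sum>S\<in>UNIV. \<Sum>T\<in>UNIV. if S \<inter> T = {} then H S T else 0)"
      by (intro sum.cong refl sum.mono_neutral_cong_left) auto
    also have "\<dots> = subst_hom scale y f * subst_hom scale y g"
      unfolding subst_hom_def sum_product
      by (intro sum.cong refl)
        (simp add: H_def scale_mult_left [symmetric] scale_mult_right [symmetric]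
          ordered_prod_mult [of y, OF sq anti] mult_ac)
    finally show ?thesis .
  qed
  have one: "subst_hom scale y 1 = 1"
  proof -
    have "subst_hom scale y 1 = (\<Sum>S\<in>(UNIV :: 'n set set). if S = {} then 1 else 0)"
      unfolding subst_hom_def by (rule sum.cong) auto
    then show ?thesis by simp
  qed
  have "module_hom gscale scale (subst_hom scale y)"
    by unfold_locales
      (simp_all add: subst_hom_def scale_left_distrib sum.distrib scale_sum_right)
  with mult one show ?thesis by (simp add: alg_hom_def)
qed

lemma subst_hom_gen: "subst_hom scale y (gen i) = y i"
proof -
  have "subst_hom scale y (gen i) = (\<Sum>S\<in>UNIV. if S = {i} then y i else 0)"
    unfolding subst_hom_def by (rule sum.cong) (auto simp: gcoeff_gen)
  then show ?thesis by simp
qed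

lemma alg_hom_eq_subst_hom:
  assumes "alg_hom gscale scale h"
  shows "h = subst_hom scale (\<lambda>i. h (gen i))"
proof
  fix f
  interpret h: module_hom gscale scale h
    using assms by (simp add: alg_hom_def)
  have "h (prod_list xs) = prod_list (map h xs)" for xs
    using assms by (induction xs) (simp_all add: alg_hom_def)
  then have "h (ordered_prod gen S) = ordered_prod (\<lambda>i. h (gen i)) S" for S
    by (simp add: ordered_prod_def comp_def)
  moreover have "h f = (\<Sum>S\<in>UNIV. scale (gcoeff f S) (h (ordered_prod gen S)))"
    by (subst grassmann_expansion [of f]) (simp only: h.sum h.scale)
  ultimately show "h f = subst_hom scale (\<lambda>i. h (gen i)) f"
    by (simp add: subst_hom_def)
qed

theorem grassmann_universal:
  fixes y :: "'n::{finite,linorder} \<Rightarrow> 'a"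
  assumes "\<And>i. y i * y i = 0"
    and "\<And>i j. i \<noteq> j \<Longrightarrow> y i * y j = - (y j * y i)"
  shows "\<exists>!h. alg_hom gscale scale h \<and> (\<forall>i. h (gen i) = y i)"
proof
  show "alg_hom gscale scale (subst_hom scale y) \<and> (\<forall>i. subst_hom scale y (gen i) = y i)"
    using alg_hom_subst_hom [OF assms] by (simp add: subst_hom_gen)
next
  fix h assume h: "alg_hom gscale scale h \<and> (\<forall>i. h (gen i) = y i)"
  then have "(\<lambda>i. h (gen i)) = y" by auto
  with alg_hom_eq_subst_hom [of h] h show "h = subst_hom scale y" by simp
qed

end

lemma gen_anticommute:
  assumes "i \<noteq> j"
  shows "gen i * gen j = - (gen j * gen i)"
proof -
  have *: "shuffle_sign {i} {j} = - (shuffle_sign {j} {i} :: 'b)" if "i < j" for i j :: 'a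
  proof -
    have "{(k, l). k \<in> {i} \<and> l \<in> {j} \<and> l < k} = {}" "{(k, l). k \<in> {j} \<and> l \<in> {i} \<and> l < k} = {(j, i)}"
      using that by auto
    then show ?thesis
      unfolding shuffle_sign_def by (simp only:) simp
  qed
  have "shuffle_sign {i} {j} = - (shuffle_sign {j} {i} :: 'b)"
    using * [of i j] * [of j i] assms by (cases "i < j") auto
  moreover have "i \<in> U \<and> U - {i} = {j} \<longleftrightarrow> j \<in> U \<and> U - {j} = {i}" for U
    using assms by blast
  ultimately show ?thesis
    by (intro grassmann_eqI) (simp add: gcoeff_gen_mult gcoeff_gen, metis)
qed

definition homogeneous :: "nat \<Rightarrow> ('k::comm_ring_1, 'n::{finite,linorder}) grassmann set" where
  "homogeneous d = grassmann.span (ordered_prod gen ` {S. card S = d})"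

definition graded_part :: "nat set \<Rightarrow> ('k::comm_ring_1, 'n::{finite,linorder}) grassmann set" where
  "graded_part D = grassmann.span (\<Union>d\<in>D. homogeneous d)"

lemma graded_part_iff: "f \<in> graded_part D \<longleftrightarrow> (\<forall>S. gcoeff f S \<noteq> 0 \<longrightarrow> card S \<in> D)"
proof
  have hom: "gcoeff g S \<noteq> 0 \<Longrightarrow> card S = d" if "g \<in> homogeneous d"
    for g :: "('a, 'b) grassmann" and d S
    using that unfolding homogeneous_def
  proof (induction arbitrary: S rule: grassmann.span_induct_alt)
    case (step c x y)
    then have "gcoeff x S \<noteq> 0 \<or> gcoeff y S \<noteq> 0" by auto
    with step show ?case by (auto simp: gcoeff_ordered_prod_gen split: if_splits)
  qed simp
  assume "f \<in> graded_part D"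
  then have "gcoeff f S \<noteq> 0 \<Longrightarrow> card S \<in> D" for S
    unfolding graded_part_def
  proof (induction arbitrary: S rule: grassmann.span_induct_alt)
    case (step c x y)
    then have "gcoeff x S \<noteq> 0 \<or> gcoeff y S \<noteq> 0" by auto
    with step hom show ?case by blast
  qed simp
  then show "\<forall>S. gcoeff f S \<noteq> 0 \<longrightarrow> card S \<in> D" by blast
next
  assume *: "\<forall>S. gcoeff f S \<noteq> 0 \<longrightarrow> card S \<in> D"
  have "gscale (gcoeff f S) (ordered_prod gen S) \<in> graded_part D" for S
  proof (cases "gcoeff f S = 0")
    case True
    then show ?thesis by (simp add: graded_part_def grassmann.span_zero)
  next
    case False
    have "(ordered_prod gen S :: ('a, 'b) grassmann) \<in> homogeneous (card S)"
      unfolding homogeneous_def by (rule grassmann.span_base) auto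
    with False * show ?thesis
      unfolding graded_part_def by (intro grassmann.span_scale grassmann.span_base) blast
  qed
  then have "(\<Sum>S\<in>UNIV. gscale (gcoeff f S) (ordered_prod gen S)) \<in> graded_part D"
    unfolding graded_part_def by (intro grassmann.span_sum) simp
  then show "f \<in> graded_part D" by (simp flip: grassmann_expansion)
qed

abbreviation odd_part :: "('k::comm_ring_1, 'n::{finite,linorder}) grassmann set" where
  "odd_part \<equiv> graded_part {d. odd d}"

abbreviation aug_ideal :: "('k::comm_ring_1, 'n::{finite,linorder}) grassmann set" where
  "aug_ideal \<equiv> graded_part {1..}"

definition aug_ideal_power :: "nat \<Rightarrow> ('k::comm_ring_1, 'n::{finite,linorder}) grassmann set" where
  "aug_ideal_power k = grassmann.span {prod_list fs | fs. length fs = k \<and> set fs \<subseteq> aug_ideal}"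

type_synonym ('k, 'n) gmap = "('k, 'n) grassmann \<Rightarrow> ('k, 'n) grassmann"

definition grassmann_Aut :: "('k::comm_ring_1, 'n::{finite,linorder}) gmap monoid" where
  "grassmann_Aut = alg_Aut gscale"

definition grassmann_U :: "('k::comm_ring_1, 'n::{finite,linorder}) gmap set" where
  "grassmann_U = {\<sigma> \<in> carrier grassmann_Aut. \<forall>i. \<sigma> (gen i) - gen i \<in> aug_ideal_power 2}"

definition grassmann_Gamma :: "('k::comm_ring_1, 'n::{finite,linorder}) gmap set" where
  "grassmann_Gamma =
     {\<sigma> \<in> carrier grassmann_Aut. \<forall>i. \<sigma> (gen i) - gen i \<in> odd_part \<inter> aug_ideal_power 3}"

definition grassmann_Omega :: "('k::comm_ring_1, 'n::{finite,linorder}) gmap set" where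
  "grassmann_Omega = {inner_aut (1 + a) | a. a \<in> odd_part}"

definition linear_subst :: "'k::comm_ring_1 ^ 'n::{finite,linorder} ^ 'n::{finite,linorder} \<Rightarrow> ('k, 'n) gmap" where
  "linear_subst A = subst_hom gscale (\<lambda>i. \<Sum>j\<in>UNIV. gscale (A $ i $ j) (gen j))"

text \<open>The group \<open>GL\<^sub>n(K)\<^sup>o\<^sup>p\<close>, acting by \<open>x\<^sub>i \<mapsto> \<Sum>\<^sub>j a\<^sub>i\<^sub>j x\<^sub>j\<close>; composition reverses the order of
  matrix multiplication.\<close>

definition grassmann_GL :: "('k::comm_ring_1, 'n::{finite,linorder}) gmap set" where
  "grassmann_GL = {linear_subst A | A. invertible A}"

end

theory Submission
  imports Defs
begin

text \<open>
  Reducedness forces \<open>\<sigma>(x\<^sub>i)\<close> to have zero constant term, so taking the linear part of the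
  \<open>\<sigma>(x\<^sub>i)\<close> is an antihomomorphism from \<open>G\<close> onto the general linear group with kernel \<open>U\<close> and section
  \<open>A \<mapsto> \<sigma>\<^sub>A\<close>.

  As \<open>2\<close> is invertible, odd elements \<open>a\<close> satisfy \<open>a\<^sup>2 = 0\<close>, so \<open>\<omega>\<^bsub>1+a\<^esub>\<close> fixes even elements and sends
  an odd \<open>f\<close> to \<open>f + 2af\<close>; thus \<open>a \<mapsto> \<omega>\<^bsub>1+a\<^esub>\<close> is additive and \<open>\<Omega>\<close> is abelian.
  For \<open>\<sigma> \<in> U\<close> write \<open>\<sigma>(x\<^sub>i) = p\<^sub>i + q\<^sub>i\<close> with \<open>p\<^sub>i\<close> even and \<open>q\<^sub>i\<close> odd. The \<open>q\<^sub>i\<close> anticommute, so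
  \<open>\<gamma>(x\<^sub>i) = q\<^sub>i\<close> defines an element of \<open>\<Gamma>\<close>, and the odd part of \<open>\<sigma>(x\<^sub>i)\<sigma>(x\<^sub>j) + \<sigma>(x\<^sub>j)\<sigma>(x\<^sub>i) = 0\<close>
  reads \<open>p\<^sub>i q\<^sub>j + p\<^sub>j q\<^sub>i = 0\<close>. This is exactly the condition for solving \<open>p\<^sub>i = 2 a q\<^sub>i\<close> with a single
  odd \<open>a\<close>, and then \<open>\<sigma> = \<omega>\<^bsub>1+a\<^esub>\<gamma>\<close>. Since \<open>\<Omega>\<close> is abelian and \<open>\<gamma>\<omega>\<^bsub>1+a\<^esub>\<gamma>\<^sup>-\<^sup>1 = \<omega>\<^bsub>1+\<gamma>(a)\<^esub>\<close>
  for \<open>\<gamma> \<in> \<Gamma>\<close>, normality of \<open>\<Omega>\<close> in \<open>U = \<Omega>\<Gamma>\<close> follows.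
\<close>

subsection \<open>Graded parts and signs\<close>

definition gproj :: "nat set \<Rightarrow> ('k::comm_ring_1, 'n::{finite,linorder}) gmap" where
  "gproj D f = Grassmann (\<lambda>S. if card S \<in> D then gcoeff f S else 0)"

abbreviation even_proj :: "('k::comm_ring_1, 'n::{finite,linorder}) gmap" where
  "even_proj \<equiv> gproj {d. even d}"

abbreviation odd_proj :: "('k::comm_ring_1, 'n::{finite,linorder}) gmap" where
  "odd_proj \<equiv> gproj {d. odd d}"

lemma gcoeff_gproj [simp]: "gcoeff (gproj D f) S = (if card S \<in> D then gcoeff f S else 0)"
  by (simp add: gproj_def)

lemma gproj_in_graded_part [simp]: "gproj D f \<in> graded_part D"
  by (auto simp: graded_part_iff)

lemma gproj_eq_self: "f \<in> graded_part D \<Longrightarrow> gproj D f = f"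
  by (rule grassmann_eqI) (auto simp: graded_part_iff)

lemma gproj_eq_0: "f \<in> graded_part E \<Longrightarrow> D \<inter> E = {} \<Longrightarrow> gproj D f = 0"
  by (rule grassmann_eqI) (force simp: graded_part_iff)

lemma gproj_add: "gproj D (f + g) = gproj D f + gproj D g"
  by (rule grassmann_eqI) auto

lemma gproj_zero: "gproj D 0 = 0"
  by (rule grassmann_eqI) auto

lemma even_odd_decomp: "even_proj f + odd_proj f = f"
  by (rule grassmann_eqI) auto

lemma graded_part_mono: "f \<in> graded_part D \<Longrightarrow> D \<subseteq> E \<Longrightarrow> f \<in> graded_part E"
  by (auto simp: graded_part_iff)

lemma graded_part_zero [simp]: "0 \<in> graded_part D"
  by (simp add: graded_part_iff)

lemma graded_part_add: "f \<in> graded_part D \<Longrightarrow> g \<in> graded_part D \<Longrightarrow> f + g \<in> graded_part D"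
  unfolding graded_part_def by (rule grassmann.span_add)

lemma graded_part_diff: "f \<in> graded_part D \<Longrightarrow> g \<in> graded_part D \<Longrightarrow> f - g \<in> graded_part D"
  unfolding graded_part_def by (rule grassmann.span_diff)

lemma graded_part_uminus: "f \<in> graded_part D \<Longrightarrow> - f \<in> graded_part D"
  unfolding graded_part_def by (rule grassmann.span_neg)

lemma graded_part_scale: "f \<in> graded_part D \<Longrightarrow> gscale c f \<in> graded_part D"
  unfolding graded_part_def by (rule grassmann.span_scale)

lemma graded_part_sum: "(\<And>i. i \<in> I \<Longrightarrow> f i \<in> graded_part D) \<Longrightarrow> sum f I \<in> graded_part D"
  unfolding graded_part_def by (rule grassmann.span_sum)

lemma gen_in_graded_part: "1 \<in> D \<Longrightarrow> gen i \<in> graded_part D"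
  by (simp add: graded_part_iff gcoeff_gen)

lemma one_in_graded_part: "0 \<in> D \<Longrightarrow> 1 \<in> graded_part D"
  by (simp add: graded_part_iff)

text \<open>A nonzero coefficient at \<open>U\<close> comes from a splitting of \<open>U\<close>
  into disjoint sets \<open>S\<close> and \<open>U - S\<close>, whose cardinalities add up to that
  of \<open>U\<close>.\<close>

lemma graded_part_mult:
  assumes f: "f \<in> graded_part D" and g: "g \<in> graded_part E"
    and DE: "\<And>d e. d \<in> D \<Longrightarrow> e \<in> E \<Longrightarrow> d + e \<in> F"
  shows "f * g \<in> graded_part F"
  unfolding graded_part_iff
proof (intro allI impI)
  fix U assume "gcoeff (f * g) U \<noteq> 0"
  then obtain S where S: "S \<subseteq> U" "shuffle_sign S (U - S) * gcoeff f S * gcoeff g (U - S) \<noteq> 0"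
    unfolding gcoeff_mult by (elim sum.not_neutral_contains_not_neutral) auto
  then have "gcoeff f S \<noteq> 0" "gcoeff g (U - S) \<noteq> 0" by auto
  with f g have "card S \<in> D" "card (U - S) \<in> E" by (auto simp: graded_part_iff)
  then have "card S + card (U - S) \<in> F" by (rule DE)
  moreover have "card S + card (U - S) = card U"
    using S(1) by (simp add: card_Diff_subset card_mono)
  ultimately show "card U \<in> F" by simp
qed

text \<open>No monomial has degree above the number of generators; this ends the degree-by-degree
  arguments in \<open>unipotent_bij\<close>.\<close>

lemma graded_part_high:
  fixes f :: "('k::comm_ring_1, 'n::{finite,linorder}) grassmann"
  assumes "f \<in> graded_part {d..}" "CARD('n) < d"
  shows "f = 0"
proof (rule grassmann_eqI)
  fix S :: "'n set"
  have "card S \<le> CARD('n)" by (simp add: card_mono)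
  with assms show "gcoeff f S = gcoeff 0 S" by (force simp: graded_part_iff)
qed

text \<open>\<open>E k\<close> holds the possible degrees of a product of \<open>k\<close> factors
  with degrees in \<open>D\<close>. Two instances are used: the parity class of \<open>k\<close>,
  and \<open>{k..}\<close> for the degree filtration.\<close>

lemma ordered_prod_in_graded_part:
  fixes y :: "'n::{finite,linorder} \<Rightarrow> ('k::comm_ring_1, 'm::{finite,linorder}) grassmann"
  assumes y: "\<And>i. y i \<in> graded_part D" and D0: "0 \<in> E 0"
    and DE: "\<And>k d e. d \<in> D \<Longrightarrow> e \<in> E k \<Longrightarrow> d + e \<in> E (Suc k)"
  shows "ordered_prod y S \<in> graded_part (E (card S))"
proof -
  have "finite S" by simp
  then show ?thesis
  proof (induction S rule: finite_linorder_min_induct)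
    case empty
    then show ?case using D0 by (simp add: one_in_graded_part)
  next
    case (insert b A)
    then have "b \<notin> A" by auto
    with insert show ?case
      by (auto simp: ordered_prod_insert_min intro!: graded_part_mult [OF y] DE)
  qed
qed

section \<open>Powers of the augmentation ideal\<close>

lemma prod_list_in_graded_part:
  fixes fs :: "('k::comm_ring_1, 'n::{finite,linorder}) grassmann list"
  assumes "set fs \<subseteq> aug_ideal"
  shows "prod_list fs \<in> graded_part {length fs..}"
  using assms
  by (induction fs) (auto simp: one_in_graded_part intro!: graded_part_mult)

text \<open>Degrees add under multiplication, and conversely a monomial of degree at least
  \<open>k\<close> splits into \<open>k\<close> factors of positive degree. This turns the
  conditions defining \<open>grassmann_U\<close> and \<open>grassmann_Gamma\<close> into conditions
  on coefficients. For \<open>k = 0\<close> the left side would only be the span of 1.\<close>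

lemma aug_ideal_power_eq:
  assumes "0 < k"
  shows "aug_ideal_power k = (graded_part {k..} :: ('k::comm_ring_1, 'n::{finite,linorder}) grassmann set)"
proof
  let ?P = "{prod_list fs | fs. length fs = k \<and> set fs \<subseteq> (aug_ideal :: ('k, 'n) grassmann set)}"
  have "grassmann.subspace (graded_part {k..} :: ('k, 'n) grassmann set)"
    unfolding graded_part_def by (rule grassmann.subspace_span)
  moreover have "?P \<subseteq> graded_part {k..}"
    using prod_list_in_graded_part by blast
  ultimately show "aug_ideal_power k \<subseteq> (graded_part {k..} :: ('k, 'n) grassmann set)"
    unfolding aug_ideal_power_def by (intro grassmann.span_minimal)
  show "graded_part {k..} \<subseteq> (aug_ideal_power k :: ('k, 'n) grassmann set)"
  proof
    fix f :: "('k, 'n) grassmann"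
    assume f: "f \<in> graded_part {k..}"
    have mono: "ordered_prod gen S \<in> ?P" if "k \<le> card S" for S :: "'n set"
    proof -
      obtain j where k: "k = Suc j" using assms by (cases k) auto
      define l where "l = sorted_list_of_set S"
      \<comment> \<open>The first \<open>k - 1\<close> generators stay single; all remaining ones,
        at least one, are merged into the last factor, so that there are exactly \<open>k\<close>
        factors.\<close>
      define fs :: "('k, 'n) grassmann list"
        where "fs = map gen (take j l) @ [prod_list (map gen (drop j l))]"
      have len: "length l = card S" by (simp add: l_def)
      have "prod_list (map gen (drop j l)) \<in> (graded_part {length (drop j l)..} :: ('k, 'n) grassmann set)"
        using prod_list_in_graded_part [of "map gen (drop j l) :: ('k, 'n) grassmann list"]
        by (simp add: image_subset_iff gen_in_graded_part)
      then have "prod_list (map gen (drop j l)) \<in> (aug_ideal :: ('k, 'n) grassmann set)"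
        by (rule graded_part_mono) (use that len k in auto)
      then have "set fs \<subseteq> aug_ideal"
        by (auto simp: fs_def gen_in_graded_part)
      moreover have "length fs = k" using that len k by (simp add: fs_def)
      moreover have "prod_list fs = ordered_prod gen S"
      proof -
        have "prod_list fs = prod_list (map gen (take j l @ drop j l))"
          unfolding fs_def map_append by simp
        then show ?thesis by (simp add: ordered_prod_def l_def)
      qed
      ultimately show ?thesis by (intro CollectI exI [of _ fs] conjI) simp_all
    qed
    have "gscale (gcoeff f S) (ordered_prod gen S) \<in> aug_ideal_power k" for S
    proof (cases "gcoeff f S = 0")
      case True
      then show ?thesis by (simp add: aug_ideal_power_def grassmann.span_zero)
    next
      case False
      with f have "k \<le> card S" by (auto simp: graded_part_iff)
      from mono [OF this] show ?thesis
        unfolding aug_ideal_power_def by (intro grassmann.span_scale grassmann.span_base)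
    qed
    then have "(\<Sum>S\<in>UNIV. gscale (gcoeff f S) (ordered_prod gen S)) \<in> aug_ideal_power k"
      unfolding aug_ideal_power_def by (intro grassmann.span_sum) simp
    then show "f \<in> aug_ideal_power k" by (simp flip: grassmann_expansion)
  qed
qed

section \<open>Shuffle signs and graded commutativity\<close>

lemma shuffle_sign_square: "shuffle_sign S T * shuffle_sign S T = (1 :: 'k::comm_ring_1)"
  unfolding shuffle_sign_def by (simp flip: power_add power_mult_distrib)

text \<open>Since \<open>S\<close> and \<open>T\<close> are disjoint, every pair in
  \<open>S \<times> T\<close> is an inversion for exactly one of the two orders, so the two
  inversion counts sum to \<open>card S * card T\<close>.\<close>

lemma shuffle_sign_swap:
  fixes S T :: "'n::{finite,linorder} set"
  assumes "S \<inter> T = {}"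
  shows "shuffle_sign T S = (- 1) ^ (card S * card T) * (shuffle_sign S T :: 'k::comm_ring_1)"
proof -
  let ?A = "{(i, j). i \<in> S \<and> j \<in> T \<and> j < i}" and ?B = "{(i, j). i \<in> T \<and> j \<in> S \<and> j < i}"
  let ?B' = "{(i, j). i \<in> S \<and> j \<in> T \<and> i < j}"
  have "S \<times> T = ?A \<union> ?B'"
  proof (intro equalityI subsetI)
    fix p assume "p \<in> S \<times> T"
    then obtain i j where p: "p = (i, j)" "i \<in> S" "j \<in> T" by blast
    then have "i \<noteq> j" using assms by auto
    with p show "p \<in> ?A \<union> ?B'" by auto
  qed auto
  moreover have "?A \<inter> ?B' = {}" by (auto dest: less_asym)
  ultimately have "card (S \<times> T) = card ?A + card ?B'"
    by (simp add: card_Un_disjoint)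
  also have "bij_betw prod.swap ?B' ?B"
    by (rule bij_betw_byWitness [where f' = prod.swap]) auto
  then have "card ?B' = card ?B" by (rule bij_betw_same_card)
  finally have "card S * card T = card ?A + card ?B" by (simp add: card_cartesian_product)
  then have "(- 1) ^ (card S * card T) * shuffle_sign S T =
      shuffle_sign T S * (shuffle_sign S T * shuffle_sign S T :: 'k)"
    by (simp add: shuffle_sign_def power_add mult_ac)
  then show ?thesis by (simp add: shuffle_sign_square)
qed

text \<open>When all pairs of degrees occurring in \<open>f\<close> and \<open>g\<close> give the
  same sign \<open>c\<close>, the monomial signs can be pulled out of the whole product. The cases
  \<open>c = 1\<close> and \<open>c = - 1\<close> give the next two lemmas.\<close>

lemma grassmann_mult_swap:
  fixes f g :: "('k::comm_ring_1, 'n::{finite,linorder}) grassmann"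
  assumes "\<And>S T. gcoeff f S \<noteq> 0 \<Longrightarrow> gcoeff g T \<noteq> 0 \<Longrightarrow> (- 1) ^ (card S * card T) = (c :: 'k)"
  shows "g * f = gscale c (f * g)"
proof (rule grassmann_eqI)
  fix U
  have "gcoeff (g * f) U =
      (\<Sum>S\<in>Pow U. shuffle_sign (U - S) S * gcoeff g (U - S) * gcoeff f S)"
    unfolding gcoeff_mult
    by (rule sum.reindex_bij_witness [where i = "\<lambda>S. U - S" and j = "\<lambda>S. U - S"])
      (auto simp: double_diff)
  also have "\<dots> = (\<Sum>S\<in>Pow U. c * (shuffle_sign S (U - S) * gcoeff f S * gcoeff g (U - S)))"
  proof (rule sum.cong)
    fix S
    have "shuffle_sign (U - S) S = (- 1) ^ (card S * card (U - S)) * (shuffle_sign S (U - S) :: 'k)"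
      by (rule shuffle_sign_swap) auto
    then show "shuffle_sign (U - S) S * gcoeff g (U - S) * gcoeff f S =
        c * (shuffle_sign S (U - S) * gcoeff f S * gcoeff g (U - S))"
      using assms [of S "U - S"]
      by (cases "gcoeff f S = 0 \<or> gcoeff g (U - S) = 0") (auto simp: mult_ac)
  qed simp
  finally show "gcoeff (g * f) U = gcoeff (gscale c (f * g)) U"
    by (simp add: gcoeff_mult sum_distrib_left)
qed

lemma even_mult_commute:
  assumes "f \<in> graded_part {d. even d}"
  shows "g * f = f * g"
proof -
  have "g * f = gscale 1 (f * g)"
    by (rule grassmann_mult_swap) (use assms in \<open>auto simp: graded_part_iff\<close>)
  then show ?thesis by simp
qed

lemma odd_mult_anticommute:
  assumes "f \<in> odd_part" "g \<in> odd_part"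
  shows "g * f = - (f * g)"
proof -
  have "g * f = gscale (- 1) (f * g)"
    by (rule grassmann_mult_swap) (use assms in \<open>auto simp: graded_part_iff\<close>)
  then show ?thesis by simp
qed

lemma double_eq_0:
  fixes f :: "('k::comm_ring_1, 'n::{finite,linorder}) grassmann"
  assumes half: "\<exists>h::'k. 2 * h = 1" and "f + f = 0"
  shows "f = 0"
proof (rule grassmann_eqI)
  fix S
  obtain h :: 'k where h: "2 * h = 1" using half by blast
  have "2 * gcoeff f S = gcoeff (f + f) S" by simp
  also have "\<dots> = 0" using assms(2) by simp
  finally have "h * (2 * gcoeff f S) = 0" by simp
  then have "(2 * h) * gcoeff f S = 0" by (simp add: mult_ac)
  then show "gcoeff f S = gcoeff 0 S" by (simp add: h)
qed

text \<open>An odd element anticommutes with itself, so twice its square vanishes.\<close>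

lemma odd_square:
  fixes f :: "('k::comm_ring_1, 'n::{finite,linorder}) grassmann"
  assumes "\<exists>h::'k. 2 * h = 1" "f \<in> odd_part"
  shows "f * f = 0"
proof (rule double_eq_0 [OF assms(1)])
  have "f * f = - (f * f)" by (intro odd_mult_anticommute assms(2))
  then show "f * f + f * f = 0" by (simp add: eq_neg_iff_add_eq_0)
qed

text \<open>Odd elements satisfy the defining relations, so generators may be sent to arbitrary odd
  elements. Both the linear substitutions and the \<open>\<Gamma>\<close>-factor of an element of
  \<open>grassmann_U\<close> arise this way.\<close>

lemma alg_hom_odd_subst:
  fixes y :: "'n::{finite,linorder} \<Rightarrow> ('k::comm_ring_1, 'm::{finite,linorder}) grassmann"
  assumes "\<exists>h::'k. 2 * h = 1" "\<And>i. y i \<in> odd_part"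
  shows "alg_hom gscale gscale (subst_hom gscale y)"
  by (intro grassmann.alg_hom_subst_hom odd_square odd_mult_anticommute assms)

section \<open>The group of algebra automorphisms\<close>

lemma (in algebra_over) group_alg_Aut: "group (alg_Aut scale)"
proof (rule groupI)
  have comp: "alg_hom scale scale (f \<circ> g)" if "alg_hom scale scale f" "alg_hom scale scale g" for f g
    using that by (auto simp: alg_hom_def intro: module_hom_compose)
  show "x \<otimes>\<^bsub>alg_Aut scale\<^esub> y \<in> carrier (alg_Aut scale)"
    if "x \<in> carrier (alg_Aut scale)" "y \<in> carrier (alg_Aut scale)" for x y
    using that comp by (auto simp: alg_Aut_def bij_comp)
  show "\<one>\<^bsub>alg_Aut scale\<^esub> \<in> carrier (alg_Aut scale)"
    using module_hom_id by (simp add: alg_Aut_def alg_hom_def id_def bij_betw_def)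
  show "\<exists>y\<in>carrier (alg_Aut scale). y \<otimes>\<^bsub>alg_Aut scale\<^esub> x = \<one>\<^bsub>alg_Aut scale\<^esub>"
    if "x \<in> carrier (alg_Aut scale)" for x
  proof -
    have x: "alg_hom scale scale x" "bij x" using that by (auto simp: alg_Aut_def)
    interpret x: module_hom scale scale x using x(1) by (simp add: alg_hom_def)
    have inj: "x (inv_into UNIV x a) = a" "inv_into UNIV x (x a) = a" for a
      using x(2) by (simp_all add: bij_is_surj surj_f_inv_f bij_is_inj)
    have eqI: "inv_into UNIV x a = b" if "a = x b" for a b
      using that inj by simp
    have "alg_hom scale scale (inv_into UNIV x)"
      unfolding alg_hom_def
    proof (intro conjI allI)
      show "module_hom scale scale (inv_into UNIV x)"
        by unfold_locales (auto intro!: eqI simp: x.add x.scale inj)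
    qed (use x in \<open>auto intro!: eqI simp: inj alg_hom_def\<close>)
    moreover have "bij (inv_into UNIV x)" by (simp add: x bij_imp_bij_inv)
    ultimately show ?thesis
      using inj by (intro bexI [of _ "inv_into UNIV x"]) (auto simp: alg_Aut_def)
  qed
qed (auto simp: alg_Aut_def)

subsection \<open>Algebra homomorphisms and the filtration by degree\<close>

lemma alg_homD:
  assumes "alg_hom s t f"
  shows "f (x + y) = f x + f y" "f (x - y) = f x - f y" "f (- x) = - f x" "f 0 = 0"
    "f 1 = 1" "f (x * y) = f x * f y" "f (s c x) = t c (f x)"
proof -
  interpret module_hom s t f using assms by (simp add: alg_hom_def)
  show "f (x + y) = f x + f y" "f (x - y) = f x - f y" "f (- x) = - f x" "f 0 = 0"
    "f (s c x) = t c (f x)"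
    by (simp_all add: add diff neg zero scale)
  show "f 1 = 1" "f (x * y) = f x * f y" using assms by (simp_all add: alg_hom_def)
qed

lemma alg_hom_eqI:
  assumes "alg_hom gscale gscale f" "alg_hom gscale gscale g" "\<And>i. f (gen i) = g (gen i)"
  shows "f = g"
  using grassmann.alg_hom_eq_subst_hom [OF assms(1)] grassmann.alg_hom_eq_subst_hom [OF assms(2)]
  by (simp add: assms(3))

lemma alg_hom_comp:
  "alg_hom s t f \<Longrightarrow> alg_hom t u g \<Longrightarrow> alg_hom s u (g \<circ> f)"
  by (auto simp: alg_hom_def intro: module_hom_compose)

lemma carrier_grassmann_Aut: "\<sigma> \<in> carrier grassmann_Aut \<longleftrightarrow> alg_hom gscale gscale \<sigma> \<and> bij \<sigma>"
  by (simp add: grassmann_Aut_def alg_Aut_def)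

lemma mult_grassmann_Aut [simp]: "f \<otimes>\<^bsub>grassmann_Aut\<^esub> g = f \<circ> g"
  by (simp add: grassmann_Aut_def alg_Aut_def)

lemma one_grassmann_Aut [simp]: "\<one>\<^bsub>grassmann_Aut\<^esub> = id"
  by (simp add: grassmann_Aut_def alg_Aut_def)

lemma group_grassmann_Aut: "group (grassmann_Aut :: ('k::comm_ring_1, 'n::{finite,linorder}) gmap monoid)"
  unfolding grassmann_Aut_def by (rule grassmann.group_alg_Aut)

lemma inv_grassmann_Aut:
  assumes "\<sigma> \<in> carrier grassmann_Aut"
  shows "(inv\<^bsub>grassmann_Aut\<^esub> \<sigma>) (\<sigma> f) = f" "\<sigma> ((inv\<^bsub>grassmann_Aut\<^esub> \<sigma>) f) = f"
proof -
  interpret group "grassmann_Aut" by (rule group_grassmann_Aut)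
  have "inv\<^bsub>grassmann_Aut\<^esub> \<sigma> \<circ> \<sigma> = id" "\<sigma> \<circ> inv\<^bsub>grassmann_Aut\<^esub> \<sigma> = id"
    using l_inv [OF assms] r_inv [OF assms] by simp_all
  then show "(inv\<^bsub>grassmann_Aut\<^esub> \<sigma>) (\<sigma> f) = f" "\<sigma> ((inv\<^bsub>grassmann_Aut\<^esub> \<sigma>) f) = f"
    by (auto dest: fun_cong)
qed

lemma alg_hom_in_graded_part:
  assumes \<sigma>: "alg_hom gscale gscale \<sigma>"
    and "\<And>S. gcoeff f S \<noteq> 0 \<Longrightarrow> ordered_prod (\<lambda>i. \<sigma> (gen i)) S \<in> graded_part D"
  shows "\<sigma> f \<in> graded_part D"
proof -
  have "gscale (gcoeff f S) (ordered_prod (\<lambda>i. \<sigma> (gen i)) S) \<in> graded_part D" for S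
    using assms(2) [of S] by (cases "gcoeff f S = 0") (auto intro: graded_part_scale)
  then have "subst_hom gscale (\<lambda>i. \<sigma> (gen i)) f \<in> graded_part D"
    unfolding subst_hom_def by (intro graded_part_sum)
  then show ?thesis by (subst grassmann.alg_hom_eq_subst_hom [OF \<sigma>])
qed

text \<open>The Boolean \<open>p\<close> treats both parities at once: \<open>True\<close> means
  even, \<open>False\<close> means odd.\<close>

lemma alg_hom_preserves_parity:
  assumes "alg_hom gscale gscale \<sigma>" "\<And>i. \<sigma> (gen i) \<in> odd_part"
    and "f \<in> graded_part {d. even d = p}"
  shows "\<sigma> f \<in> graded_part {d. even d = p}"
proof (rule alg_hom_in_graded_part [OF assms(1)])
  fix S assume "gcoeff f S \<noteq> 0"
  then have "even (card S) = p" using assms(3) by (auto simp: graded_part_iff)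
  moreover have "ordered_prod (\<lambda>i. \<sigma> (gen i)) S \<in> graded_part {d. even d = even (card S)}"
    by (rule ordered_prod_in_graded_part [where D = "{d. odd d}"]) (use assms(2) in auto)
  ultimately show "ordered_prod (\<lambda>i. \<sigma> (gen i)) S \<in> graded_part {d. even d = p}" by simp
qed

lemma ordered_prod_in_filtration:
  fixes y :: "'n::{finite,linorder} \<Rightarrow> ('k::comm_ring_1, 'm::{finite,linorder}) grassmann"
  assumes "\<And>i. y i \<in> aug_ideal"
  shows "ordered_prod y S \<in> graded_part {card S..}"
  by (rule ordered_prod_in_graded_part [where D = "{1..}"]) (use assms in auto)

text \<open>Such a \<open>\<sigma>\<close> acts as the identity on the associated graded algebra.
  Expanding \<open>f\<close> in monomials reduces the claim to ordered products of
  generators.\<close>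

lemma unipotent_raises_filtration:
  fixes \<sigma> :: "('k::comm_ring_1, 'n::{finite,linorder}) gmap"
  assumes \<sigma>: "alg_hom gscale gscale \<sigma>" and uni: "\<And>i. \<sigma> (gen i) - gen i \<in> graded_part {2..}"
    and f: "f \<in> graded_part {k..}"
  shows "\<sigma> f - f \<in> graded_part {Suc k..}"
proof -
  have aug: "\<sigma> (gen i) \<in> aug_ideal" for i
  proof -
    have "\<sigma> (gen i) - gen i \<in> aug_ideal" using graded_part_mono [OF uni] by auto
    from graded_part_add [OF this gen_in_graded_part [of "{1..}" i]] show ?thesis by simp
  qed
  have mono: "ordered_prod (\<lambda>i. \<sigma> (gen i)) S - ordered_prod gen S \<in> graded_part {Suc (card S)..}"
    for S :: "'n set"
  proof -
    have "finite S" by simp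
    then show ?thesis
    proof (induction S rule: finite_linorder_min_induct)
      case empty
      then show ?case by simp
    next
      case (insert b A)
      let ?y = "\<lambda>i. \<sigma> (gen i)"
      have c: "card (insert b A) = Suc (card A)" using insert.hyps by (subst card_insert_disjoint) auto
      \<comment> \<open>Replacing one factor at a time: each summand contains one difference, which
        contributes the extra degree.\<close>
      have "ordered_prod ?y (insert b A) - ordered_prod gen (insert b A) =
          (?y b - gen b) * ordered_prod ?y A + gen b * (ordered_prod ?y A - ordered_prod gen A)"
        using insert.hyps by (simp add: ordered_prod_insert_min algebra_simps)
      moreover have "(?y b - gen b) * ordered_prod ?y A \<in> graded_part {Suc (Suc (card A))..}"
        by (rule graded_part_mult [OF uni ordered_prod_in_filtration [OF aug]]) auto
      moreover have "gen b * (ordered_prod ?y A - ordered_prod gen A) \<in> graded_part {Suc (Suc (card A))..}"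
        by (rule graded_part_mult [OF gen_in_graded_part [of "{1..}"] insert.IH]) auto
      ultimately show ?case unfolding c by (simp add: graded_part_add)
    qed
  qed
  have "\<sigma> f - f = subst_hom gscale (\<lambda>i. \<sigma> (gen i)) f - (\<Sum>S\<in>UNIV. gscale (gcoeff f S) (ordered_prod gen S))"
    using grassmann.alg_hom_eq_subst_hom [OF \<sigma>] grassmann_expansion [of f] by metis
  also have "\<dots> = (\<Sum>S\<in>UNIV. gscale (gcoeff f S) (ordered_prod (\<lambda>i. \<sigma> (gen i)) S - ordered_prod gen S))"
    by (simp add: subst_hom_def sum_subtractf grassmann.scale_right_diff_distrib)
  also have "\<dots> \<in> graded_part {Suc k..}"
  proof (rule graded_part_sum)
    fix S
    show "gscale (gcoeff f S) (ordered_prod (\<lambda>i. \<sigma> (gen i)) S - ordered_prod gen S) \<in> graded_part {Suc k..}"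
    proof (cases "gcoeff f S = 0")
      case False
      then have "k \<le> card S" using f by (auto simp: graded_part_iff)
      then show ?thesis by (intro graded_part_scale graded_part_mono [OF mono]) auto
    qed simp
  qed
  finally show ?thesis .
qed

text \<open>The degree filtration is finite and \<open>\<sigma> - id\<close> raises it. Hence a
  kernel element lies in every filtration step, and preimages are found by successive
  approximation.\<close>

lemma unipotent_bij:
  fixes \<sigma> :: "('k::comm_ring_1, 'n::{finite,linorder}) gmap"
  assumes \<sigma>: "alg_hom gscale gscale \<sigma>" and uni: "\<And>i. \<sigma> (gen i) - gen i \<in> graded_part {2..}"
  shows "bij \<sigma>"
proof (rule bijI)
  note raise = unipotent_raises_filtration [OF \<sigma> uni]
  have ker: "f = 0" if "\<sigma> f = 0" for f
  proof -
    have "f \<in> graded_part {k..}" for k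
    proof (induction k)
      case 0
      then show ?case by (simp add: graded_part_iff)
    next
      case (Suc k)
      from raise [OF Suc] that show ?case using graded_part_uminus by fastforce
    qed
    from graded_part_high [OF this lessI] show ?thesis .
  qed
  show "inj \<sigma>"
  proof (rule injI)
    fix f g assume "\<sigma> f = \<sigma> g"
    then have "\<sigma> (f - g) = 0" by (simp add: alg_homD [OF \<sigma>])
    from ker [OF this] show "f = g" by simp
  qed
  show "surj \<sigma>"
  proof (rule surjI)
    fix g
    have "\<exists>f. g - \<sigma> f \<in> graded_part {k..}" for k
    proof (induction k)
      case 0
      then show ?case by (simp add: graded_part_iff)
    next
      case (Suc k)
      then obtain f where "g - \<sigma> f \<in> graded_part {k..}" by blast
      \<comment> \<open>Adding the error \<open>g - \<sigma> f\<close> to \<open>f\<close> leaves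
        the new error \<open>d - \<sigma> d\<close> for \<open>d = g - \<sigma> f\<close>, which
        lies one step deeper.\<close>
      from graded_part_uminus [OF raise [OF this]]
      have "g - \<sigma> (f + (g - \<sigma> f)) \<in> graded_part {Suc k..}"
        by (simp add: alg_homD [OF \<sigma>] algebra_simps)
      then show ?case by blast
    qed
    then obtain f where "g - \<sigma> f \<in> graded_part {Suc CARD('n)..}" by blast
    from graded_part_high [OF this lessI] have "g = \<sigma> f" by simp
    then show "\<sigma> (SOME f. g = \<sigma> f) = g" by (metis (mono_tags) someI)
  qed
qed

subsection \<open>The linear part\<close>

definition linear_part :: "('k::comm_ring_1, 'n::{finite,linorder}) gmap \<Rightarrow> 'k ^ 'n::{finite,linorder} ^ 'n::{finite,linorder}" where
  "linear_part \<sigma> = (\<chi> i j. gcoeff (\<sigma> (gen i)) {j})"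

text \<open>Constants map to constants, and monomials of degree at least 2 map to degree at least 2,
  so only the linear terms of \<open>f\<close> contribute.\<close>

lemma gcoeff_alg_hom_singleton:
  fixes \<sigma> :: "('k::comm_ring_1, 'n::{finite,linorder}) gmap"
  assumes \<sigma>: "alg_hom gscale gscale \<sigma>" and aug: "\<And>i. \<sigma> (gen i) \<in> aug_ideal"
  shows "gcoeff (\<sigma> f) {j} = (\<Sum>i\<in>UNIV. gcoeff f {i} * linear_part \<sigma> $ i $ j)"
proof -
  let ?y = "\<lambda>i. \<sigma> (gen i)"
  have "gcoeff (ordered_prod ?y S) {j} = 0" if "S \<notin> range (\<lambda>i. {i})" for S :: "'n set"
  proof (cases "S = {}")
    case False
    with that have "card S \<noteq> 0" "card S \<noteq> 1" by (auto simp: card_1_singleton_iff)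
    with ordered_prod_in_filtration [of ?y S, OF aug] show ?thesis by (force simp: graded_part_iff)
  qed simp
  then have "gcoeff (subst_hom gscale ?y f) {j} =
      (\<Sum>S\<in>range (\<lambda>i. {i}). gcoeff f S * gcoeff (ordered_prod ?y S) {j})"
    unfolding subst_hom_def gcoeff_sum gcoeff_gscale
    by (intro sum.mono_neutral_right) auto
  also have "\<dots> = (\<Sum>i\<in>UNIV. gcoeff f {i} * linear_part \<sigma> $ i $ j)"
    by (subst sum.reindex) (auto simp: inj_on_def linear_part_def)
  finally show ?thesis by (subst grassmann.alg_hom_eq_subst_hom [OF \<sigma>])
qed

text \<open>Row \<open>i\<close> of \<open>linear_part \<tau>\<close> describes
  \<open>\<tau> (gen i)\<close>; applying \<open>\<sigma>\<close> multiplies this row on the right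
  by the matrix of \<open>\<sigma>\<close>, hence the reversed order.\<close>

lemma linear_part_comp:
  assumes \<sigma>: "alg_hom gscale gscale \<sigma>" and aug: "\<And>i. \<sigma> (gen i) \<in> aug_ideal"
  shows "linear_part (\<sigma> \<circ> \<tau>) = linear_part \<tau> ** linear_part \<sigma>"
  by (simp add: vec_eq_iff linear_part_def [of "\<sigma> \<circ> \<tau>"] linear_part_def [of \<tau>] matrix_matrix_mult_def
      gcoeff_alg_hom_singleton [OF assms])

lemma linear_part_id: "linear_part id = mat 1"
  by (auto simp: linear_part_def mat_def vec_eq_iff gcoeff_gen)

lemma alg_hom_linear_subst:
  fixes A :: "'k::comm_ring_1 ^ 'n::{finite,linorder} ^ 'n::{finite,linorder}"
  assumes half: "\<exists>h::'k. 2 * h = 1"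
  shows "alg_hom gscale gscale (linear_subst A)"
proof -
  let ?y = "\<lambda>i. \<Sum>j\<in>UNIV. gscale (A $ i $ j) (gen j) :: ('k, 'n) grassmann"
  have "?y i \<in> odd_part" for i
    by (auto intro!: graded_part_sum graded_part_scale gen_in_graded_part)
  then show ?thesis
    unfolding linear_subst_def by (intro alg_hom_odd_subst half)
qed

lemma linear_subst_gen: "linear_subst A (gen i) = (\<Sum>j\<in>UNIV. gscale (A $ i $ j) (gen j))"
  by (simp add: linear_subst_def grassmann.subst_hom_gen)

lemma gcoeff_sum_gscale_gen_singleton:
  "gcoeff (\<Sum>j\<in>UNIV. gscale (c j) (gen j)) {i} = c i"
  by (simp add: gcoeff_sum gcoeff_gen if_distrib cong: if_cong)

lemma linear_part_linear_subst: "linear_part (linear_subst A) = A"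
  by (simp add: vec_eq_iff linear_part_def linear_subst_gen gcoeff_sum_gscale_gen_singleton)

lemma linear_subst_comp:
  fixes A B :: "'k::comm_ring_1 ^ 'n::{finite,linorder} ^ 'n::{finite,linorder}"
  assumes half: "\<exists>h::'k. 2 * h = 1"
  shows "linear_subst A \<circ> linear_subst B = linear_subst (B ** A)"
proof (rule alg_hom_eqI)
  fix i
  note A = alg_hom_linear_subst [OF half, of A]
  interpret A: module_hom gscale gscale "linear_subst A" using A by (simp add: alg_hom_def)
  have "(linear_subst A \<circ> linear_subst B) (gen i) =
      (\<Sum>k\<in>UNIV. \<Sum>j\<in>UNIV. gscale (B $ i $ k * A $ k $ j) (gen j))"
    by (simp add: linear_subst_gen A.sum A.scale grassmann.scale_sum_right)
  also have "\<dots> = (\<Sum>j\<in>UNIV. \<Sum>k\<in>UNIV. gscale (B $ i $ k * A $ k $ j) (gen j))"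
    by (rule sum.swap)
  also have "\<dots> = linear_subst (B ** A) (gen i)"
    by (simp add: linear_subst_gen matrix_matrix_mult_def grassmann.scale_sum_left)
  finally show "(linear_subst A \<circ> linear_subst B) (gen i) = linear_subst (B ** A) (gen i)" .
qed (rule alg_hom_comp alg_hom_linear_subst [OF half])+

lemma linear_subst_mat_1:
  assumes half: "\<exists>h::'k::comm_ring_1. 2 * h = 1"
  shows "linear_subst (mat 1) = (id :: ('k, 'n::{finite,linorder}) gmap)"
proof (rule alg_hom_eqI)
  show "alg_hom gscale gscale (id :: ('k, 'n) gmap)"
    using group.is_monoid [OF group_grassmann_Aut, THEN monoid.one_closed] by (simp add: carrier_grassmann_Aut)
  fix i :: 'n
  have "linear_subst (mat 1) (gen i) = (\<Sum>j\<in>UNIV. if i = j then gen i else 0 :: ('k, 'n) grassmann)"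
    unfolding linear_subst_gen by (rule sum.cong) (auto simp: mat_def)
  then show "linear_subst (mat 1) (gen i) = (id (gen i) :: ('k, 'n) grassmann)" by simp
qed (rule alg_hom_linear_subst [OF half])

text \<open>As \<open>gen i\<close> squares to 0, so does the constant term of its image. Every use
  of reducedness goes through this lemma.\<close>

lemma grassmann_Aut_gen_in_aug_ideal:
  fixes \<sigma> :: "('k::comm_ring_1, 'n::{finite,linorder}) gmap"
  assumes reduced: "\<forall>(c::'k) m. c ^ m = 0 \<longrightarrow> c = 0" and \<sigma>: "alg_hom gscale gscale \<sigma>"
  shows "\<sigma> (gen i) \<in> aug_ideal"
proof -
  have "\<sigma> (gen i) * \<sigma> (gen i) = 0"
    by (simp flip: alg_homD(6) [OF \<sigma>] add: gen_square alg_homD(4) [OF \<sigma>])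
  then have "gcoeff (\<sigma> (gen i) * \<sigma> (gen i)) {} = 0" by simp
  then have "gcoeff (\<sigma> (gen i)) {} ^ 2 = 0" by (simp add: gcoeff_mult power2_eq_square)
  with reduced have "gcoeff (\<sigma> (gen i)) {} = 0" by blast
  then show ?thesis
    unfolding graded_part_iff by (metis atLeast_iff card_gt_0_iff finite less_one linorder_not_less not_gr0)
qed

lemma grassmann_U_iff:
  fixes \<sigma> :: "('k::comm_ring_1, 'n::{finite,linorder}) gmap"
  shows "\<sigma> \<in> grassmann_U \<longleftrightarrow>
    \<sigma> \<in> carrier grassmann_Aut \<and> (\<forall>i. \<sigma> (gen i) - gen i \<in> graded_part {2..})"
  by (simp add: grassmann_U_def aug_ideal_power_eq)

text \<open>This exhibits \<open>grassmann_U\<close> as the kernel of \<open>linear_part\<close>: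
  constant terms vanish by reducedness, so \<open>\<sigma> (gen i) - gen i\<close> starts in degree
  2 exactly when its linear terms vanish.\<close>

lemma grassmann_U_iff_linear_part:
  fixes \<sigma> :: "('k::comm_ring_1, 'n::{finite,linorder}) gmap"
  assumes reduced: "\<forall>(c::'k) m. c ^ m = 0 \<longrightarrow> c = 0"
  shows "\<sigma> \<in> grassmann_U \<longleftrightarrow> \<sigma> \<in> carrier grassmann_Aut \<and> linear_part \<sigma> = mat 1"
proof (cases "\<sigma> \<in> carrier grassmann_Aut")
  case True
  then have hom: "alg_hom gscale gscale \<sigma>" by (simp add: carrier_grassmann_Aut)
  have "\<sigma> (gen i) - gen i \<in> graded_part {2..} \<longleftrightarrow> (\<forall>j. gcoeff (\<sigma> (gen i)) {j} = (if i = j then 1 else 0))"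
    for i
  proof
    assume *: "\<sigma> (gen i) - gen i \<in> graded_part {2..}"
    show "\<forall>j. gcoeff (\<sigma> (gen i)) {j} = (if i = j then 1 else 0)"
    proof
      fix j
      have "gcoeff (\<sigma> (gen i) - gen i) {j} = 0"
        using * unfolding graded_part_iff by fastforce
      then show "gcoeff (\<sigma> (gen i)) {j} = (if i = j then 1 else 0)"
        by (auto simp: gcoeff_gen)
    qed
  next
    assume *: "\<forall>j. gcoeff (\<sigma> (gen i)) {j} = (if i = j then 1 else 0)"
    have "\<sigma> (gen i) - gen i \<in> aug_ideal"
      by (intro graded_part_diff grassmann_Aut_gen_in_aug_ideal [OF reduced hom] gen_in_graded_part) simp
    show "\<sigma> (gen i) - gen i \<in> graded_part {2..}"
      unfolding graded_part_iff
    proof (intro allI impI)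
      fix S assume S: "gcoeff (\<sigma> (gen i) - gen i) S \<noteq> 0"
      with \<open>\<sigma> (gen i) - gen i \<in> aug_ideal\<close> have "1 \<le> card S" by (auto simp: graded_part_iff)
      moreover have "card S \<noteq> 1" using S * by (auto simp: card_1_singleton_iff gcoeff_gen split: if_splits)
      ultimately show "card S \<in> {2..}" by simp
    qed
  qed
  with True show ?thesis by (simp add: grassmann_U_iff linear_part_def mat_def vec_eq_iff)
qed (simp add: grassmann_U_iff)

subsection \<open>Inner automorphisms\<close>

text \<open>The closed form of \<open>inner_aut (1 + a)\<close> for odd \<open>a\<close>.\<close>

definition omega :: "('k::comm_ring_1, 'n::{finite,linorder}) grassmann \<Rightarrow> ('k, 'n) gmap" where
  "omega a f = f + (a * odd_proj f + a * odd_proj f)"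

lemma ring_inv_eqI:
  assumes "u * v = 1" "v * u = 1"
  shows "ring_inv u = v"
  unfolding ring_inv_def
proof (rule the_equality)
  fix w assume w: "u * w = 1 \<and> w * u = 1"
  have "w = v * u * w" by (simp add: assms)
  also have "\<dots> = v" using w by (simp add: mult.assoc)
  finally show "w = v" .
qed (simp add: assms)

lemma one_plus_odd_inverse:
  fixes a :: "('k::comm_ring_1, 'n::{finite,linorder}) grassmann"
  assumes "\<exists>h::'k. 2 * h = 1" "a \<in> odd_part"
  shows "(1 + a) * (1 - a) = 1" "(1 - a) * (1 + a) = 1"
  using odd_square [OF assms] by (simp_all add: algebra_simps)

text \<open>The inverse of \<open>1 + a\<close> is \<open>1 - a\<close>. The even part
  \<open>p\<close> of \<open>f\<close> is central; for the odd part \<open>q\<close> the quadratic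
  term \<open>a * q * a\<close> vanishes because \<open>q\<close> moves past \<open>a\<close> up to
  sign and \<open>a * a = 0\<close>.\<close>

lemma inner_aut_one_plus_odd:
  fixes a :: "('k::comm_ring_1, 'n::{finite,linorder}) grassmann"
  assumes half: "\<exists>h::'k. 2 * h = 1" and a: "a \<in> odd_part"
  shows "inner_aut (1 + a) = omega a"
proof
  fix f :: "('k, 'n) grassmann"
  define p where "p = even_proj f"
  define q where "q = odd_proj f"
  have f: "f = p + q" by (simp add: p_def q_def even_odd_decomp)
  note inv = one_plus_odd_inverse [OF half a]
  have "(1 + a) * p * (1 - a) = p * ((1 + a) * (1 - a))"
    using even_mult_commute [of p "1 + a"] by (simp add: p_def mult.assoc)
  then have p: "(1 + a) * p * (1 - a) = p" by (simp add: inv)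
  have q: "(1 + a) * q * (1 - a) = q + (a * q + a * q)"
  proof -
    have "q * a = - (a * q)" by (rule odd_mult_anticommute [OF a]) (simp add: q_def)
    moreover from this have "a * (q * a) = - (a * a * q)" by (simp add: mult.assoc)
    then have "a * (q * a) = 0" by (simp add: odd_square [OF half a])
    ultimately show ?thesis by (simp add: algebra_simps)
  qed
  have "(1 + a) * f * (1 - a) = (1 + a) * p * (1 - a) + (1 + a) * q * (1 - a)"
    by (simp only: f distrib_left distrib_right)
  also have "\<dots> = omega a f"
    unfolding p q omega_def q_def [symmetric] by (simp add: f add.assoc)
  finally have "(1 + a) * f * (1 - a) = omega a f" .
  then show "inner_aut (1 + a) f = omega a f"
    by (simp add: inner_aut_def ring_inv_eqI [OF inv])
qed

lemma grassmann_Omega_eq: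
  assumes half: "\<exists>h::'k::comm_ring_1. 2 * h = 1"
  shows "grassmann_Omega = omega ` (odd_part :: ('k, 'n::{finite,linorder}) grassmann set)"
  unfolding grassmann_Omega_def Setcompr_eq_image
  by (rule image_cong) (simp_all add: inner_aut_one_plus_odd [OF half])

lemma odd_proj_odd_mult_odd_proj: "a \<in> odd_part \<Longrightarrow> odd_proj (a * odd_proj f) = 0"
  by (rule gproj_eq_0 [where E = "{d. even d}"])
    (auto intro: graded_part_mult [where D = "{d. odd d}" and E = "{d. odd d}"])

text \<open>The correction that \<open>omega b\<close> adds to its argument is even, hence invisible
  to the odd projection in \<open>omega a\<close>, and so the corrections add up.\<close>

lemma omega_comp:
  assumes "b \<in> odd_part"
  shows "omega a \<circ> omega b = omega (a + b)"
  by (rule ext) (simp add: omega_def gproj_add odd_proj_odd_mult_odd_proj [OF assms] algebra_simps)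

lemma omega_0: "omega 0 = id"
  by (rule ext) (simp add: omega_def)

lemma alg_hom_inner_aut:
  fixes u v :: "('k::comm_ring_1, 'n::{finite,linorder}) grassmann"
  assumes "u * v = 1" "v * u = 1"
  shows "alg_hom gscale gscale (inner_aut u)"
proof -
  have [simp]: "ring_inv u = v" by (rule ring_inv_eqI) (fact assms)+
  have "module_hom gscale gscale (inner_aut u)"
    by unfold_locales (simp_all add: inner_aut_def algebra_simps
        grassmann.scale_mult_left [symmetric] grassmann.scale_mult_right [symmetric])
  moreover have "inner_aut u (x * y) = inner_aut u x * inner_aut u y" for x y
  proof -
    have "u * x * v * (u * y * v) = u * x * (v * u) * y * v" by (simp only: mult.assoc)
    then show ?thesis by (simp add: inner_aut_def assms mult.assoc)
  qed
  ultimately show ?thesis by (simp add: alg_hom_def) (simp add: inner_aut_def assms)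
qed

text \<open>Multiplicativity comes from the description as an inner automorphism, bijectivity from
  the inverse \<open>omega (- a)\<close>, and the degree bound from \<open>a\<close> having no
  constant term.\<close>

lemma omega_in_U:
  fixes a :: "('k::comm_ring_1, 'n::{finite,linorder}) grassmann"
  assumes half: "\<exists>h::'k. 2 * h = 1" and a: "a \<in> odd_part"
  shows "omega a \<in> grassmann_U"
proof -
  note inv = one_plus_odd_inverse [OF half a]
  have "alg_hom gscale gscale (omega a)"
    using alg_hom_inner_aut [OF inv] by (simp add: inner_aut_one_plus_odd [OF half a])
  moreover have "bij (omega a)"
  proof (rule o_bij)
    show "omega (- a) \<circ> omega a = id" using omega_comp [OF a] by (simp add: omega_0)
    show "omega a \<circ> omega (- a) = id" using omega_comp [OF graded_part_uminus [OF a]] by (simp add: omega_0)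
  qed
  moreover have "omega a (gen i) - gen i \<in> graded_part {2..}" for i
  proof -
    have "a \<in> aug_ideal" by (rule graded_part_mono [OF a]) (auto simp: odd_pos Suc_le_eq)
    then have "a * gen i \<in> graded_part {2..}"
      by (rule graded_part_mult) (auto intro: gen_in_graded_part [of "{1..}"])
    moreover have "odd_proj (gen i) = (gen i :: ('k, 'n) grassmann)"
      by (simp add: gproj_eq_self gen_in_graded_part)
    ultimately show ?thesis by (simp add: omega_def graded_part_add)
  qed
  ultimately show ?thesis by (simp add: grassmann_U_iff carrier_grassmann_Aut)
qed

subsection \<open>Parity preserving automorphisms\<close>

text \<open>An odd element of degree at least 2 has degree at least 3, so the cubic condition
  reduces to membership in \<open>grassmann_U\<close> together with oddness of the images.\<close>

lemma grassmann_Gamma_iff: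
  fixes \<sigma> :: "('k::comm_ring_1, 'n::{finite,linorder}) gmap"
  shows "\<sigma> \<in> grassmann_Gamma \<longleftrightarrow> \<sigma> \<in> grassmann_U \<and> (\<forall>i. \<sigma> (gen i) \<in> odd_part)"
proof -
  have "\<sigma> (gen i) - gen i \<in> odd_part \<inter> graded_part {3..} \<longleftrightarrow>
      \<sigma> (gen i) - gen i \<in> graded_part {2..} \<and> \<sigma> (gen i) \<in> odd_part" for i
  proof -
    have gen: "gen i \<in> odd_part" by (simp add: gen_in_graded_part)
    have "\<sigma> (gen i) \<in> odd_part \<longleftrightarrow> \<sigma> (gen i) - gen i \<in> odd_part"
      using graded_part_diff [OF _ gen, of "\<sigma> (gen i)"] graded_part_add [OF _ gen, of "\<sigma> (gen i) - gen i"]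
      by auto
    moreover have "d \<in> {3..} \<longleftrightarrow> d \<in> {2..}" if "odd d" for d :: nat
      using that by (cases "d = 2") auto
    then have "f \<in> odd_part \<inter> graded_part {3..} \<longleftrightarrow> f \<in> graded_part {2..} \<and> f \<in> odd_part"
      for f :: "('k, 'n) grassmann"
      unfolding Int_iff graded_part_iff by (metis mem_Collect_eq)
    ultimately show ?thesis by simp
  qed
  then show ?thesis by (auto simp: grassmann_Gamma_def grassmann_U_iff aug_ideal_power_eq)
qed

text \<open>For the converse, the component \<open>r\<close> of the wrong parity has an image of
  both parities; this image is 0, and injectivity gives \<open>r = 0\<close>. The converse carries
  parity over to inverses.\<close>

lemma grassmann_Gamma_parity_iff:
  fixes \<sigma> :: "('k::comm_ring_1, 'n::{finite,linorder}) gmap"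
  assumes "\<sigma> \<in> grassmann_Gamma"
  shows "\<sigma> f \<in> graded_part {d. even d = p} \<longleftrightarrow> f \<in> graded_part {d. even d = p}"
proof
  have hom: "alg_hom gscale gscale \<sigma>" and bij: "bij \<sigma>" and odd: "\<And>i. \<sigma> (gen i) \<in> odd_part"
    using assms by (auto simp: grassmann_Gamma_iff grassmann_U_iff carrier_grassmann_Aut)
  note pres = alg_hom_preserves_parity [OF hom odd]
  show "\<sigma> f \<in> graded_part {d. even d = p}" if "f \<in> graded_part {d. even d = p}"
    using that by (rule pres)
  assume *: "\<sigma> f \<in> graded_part {d. even d = p}"
  define g where "g = gproj {d. even d = p} f"
  define r where "r = gproj {d. even d = (\<not> p)} f"
  have f: "f = g + r" unfolding g_def r_def by (rule grassmann_eqI) auto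
  have "\<sigma> g \<in> graded_part {d. even d = p}" "\<sigma> r \<in> graded_part {d. even d = (\<not> p)}"
    unfolding g_def r_def by (rule pres gproj_in_graded_part)+
  moreover from this have "\<sigma> f - \<sigma> g \<in> graded_part {d. even d = p}"
    by (intro graded_part_diff *)
  then have "\<sigma> r \<in> graded_part {d. even d = p}" by (simp add: f alg_homD [OF hom])
  ultimately have "\<sigma> r = 0"
    by (intro grassmann_eqI) (auto simp: graded_part_iff)
  then have "\<sigma> r = \<sigma> 0" by (simp add: alg_homD [OF hom])
  then have "r = 0" using bij by (simp add: bij_is_inj inj_eq)
  then show "f \<in> graded_part {d. even d = p}" by (simp add: f) (simp add: g_def)
qed

lemmas grassmann_Gamma_even_iff = grassmann_Gamma_parity_iff [where p = True, simplified]
  and grassmann_Gamma_odd_iff = grassmann_Gamma_parity_iff [where p = False, simplified]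

lemma grassmann_Gamma_odd_proj:
  assumes "\<sigma> \<in> grassmann_Gamma"
  shows "odd_proj (\<sigma> f) = \<sigma> (odd_proj f)"
proof -
  have hom: "alg_hom gscale gscale \<sigma>"
    using assms by (auto simp: grassmann_Gamma_iff grassmann_U_iff carrier_grassmann_Aut)
  have "odd_proj (\<sigma> (even_proj f + odd_proj f)) = odd_proj (\<sigma> (even_proj f)) + odd_proj (\<sigma> (odd_proj f))"
    by (simp only: alg_homD [OF hom] gproj_add)
  also have "odd_proj (\<sigma> (even_proj f)) = 0"
    by (rule gproj_eq_0 [where E = "{d. even d}"]) (auto simp: grassmann_Gamma_even_iff [OF assms])
  also have "odd_proj (\<sigma> (odd_proj f)) = \<sigma> (odd_proj f)"
    by (rule gproj_eq_self) (simp add: grassmann_Gamma_odd_iff [OF assms])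
  finally show ?thesis by (simp add: even_odd_decomp)
qed

text \<open>The conjugation rule for \<open>omega\<close> in a form without inverses; it yields the
  normality of \<open>grassmann_Omega\<close>.\<close>

lemma grassmann_Gamma_comp_omega:
  assumes "\<sigma> \<in> grassmann_Gamma"
  shows "\<sigma> \<circ> omega a = omega (\<sigma> a) \<circ> \<sigma>"
proof -
  have hom: "alg_hom gscale gscale \<sigma>"
    using assms by (auto simp: grassmann_Gamma_iff grassmann_U_iff carrier_grassmann_Aut)
  show ?thesis
    by (rule ext) (simp add: omega_def alg_homD [OF hom] grassmann_Gamma_odd_proj [OF assms])
qed

text \<open>The coefficient of the common quotient at \<open>T\<close> is read off from any \<open>e\<^sub>i\<close> with
  \<open>i \<notin> T\<close>; the relation says that the choice of \<open>i\<close> does not matter.\<close>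

lemma common_right_quotient_by_gens:
  fixes e :: "'n::{finite,linorder} \<Rightarrow> ('k::comm_ring_1, 'n) grassmann"
  assumes anti: "\<And>i j. i \<noteq> j \<Longrightarrow> gen i * e j = - (gen j * e i)"
    and sq: "\<And>i. gen i * e i = 0"
    and even: "\<And>i. e i \<in> graded_part {d. even d}"
  obtains c where "c \<in> odd_part" "\<And>i. e i = gen i * c"
proof -
  define s where "s i T = (shuffle_sign {i} T :: 'k)" for i :: 'n and T
  have s_square: "s i T * s i T = 1" for i T by (simp add: s_def shuffle_sign_square)
  \<comment> \<open>Both sides are candidates for the coefficient of the quotient at
    \<open>T\<close>. They are compared through the coefficients of \<open>gen j * e i\<close> and
    \<open>gen i * e j\<close> at \<open>T\<close> enlarged by \<open>i\<close> and
    \<open>j\<close>.\<close>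
  have key: "s i T * gcoeff (e i) (insert i T) = s j T * gcoeff (e j) (insert j T)"
    if ij: "i \<notin> T" "j \<notin> T" for i j T
  proof (cases "i = j")
    case False
    have sT: "s j (insert i T) = s j {i} * s j T" "s i (insert j T) = s i {j} * s i T"
      using shuffle_sign_Un_right [of "{i}" T "{j}"] shuffle_sign_Un_right [of "{j}" T "{i}"] ij
      by (simp_all add: s_def)
    \<comment> \<open>This sign cancels the one in \<open>anti\<close>.\<close>
    have sw: "s i {j} = - s j {i}"
      using shuffle_sign_swap [of "{j}" "{i}"] False by (simp add: s_def)
    have "gcoeff (gen j * e i) (insert i (insert j T)) = - gcoeff (gen i * e j) (insert i (insert j T))"
      using anti [of i j] False by simp
    moreover have "insert i (insert j T) - {j} = insert i T" "insert i (insert j T) - {i} = insert j T"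
      using ij False by auto
    ultimately have "s j {i} * (s j T * gcoeff (e i) (insert i T)) =
        s j {i} * (s i T * gcoeff (e j) (insert j T))"
      by (simp add: gcoeff_gen_mult s_def [symmetric] sT sw mult.assoc)
    then have "s j {i} * s j {i} * (s j T * gcoeff (e i) (insert i T)) =
        s j {i} * s j {i} * (s i T * gcoeff (e j) (insert j T))"
      by (simp only: mult.assoc)
    then have *: "s j T * gcoeff (e i) (insert i T) = s i T * gcoeff (e j) (insert j T)"
      by (simp add: s_square)
    have "s i T * gcoeff (e i) (insert i T) = s i T * ((s j T * s j T) * gcoeff (e i) (insert i T))"
      by (simp add: s_square)
    also have "\<dots> = s i T * s j T * (s j T * gcoeff (e i) (insert i T))"
      by (simp only: mult.assoc)
    also have "\<dots> = (s i T * s i T) * (s j T * gcoeff (e j) (insert j T))"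
      by (simp only: * mult_ac)
    finally show ?thesis by (simp add: s_square)
  qed simp
  define r where "r T = (SOME i. i \<notin> T)" for T :: "'n set"
  \<comment> \<open>Every generator annihilates the top monomial, so the coefficient at
    \<open>UNIV\<close> is free; the value 0 keeps \<open>c\<close> odd whatever the number of
    generators.\<close>
  define c where "c = Grassmann (\<lambda>T. if T = UNIV then 0 else s (r T) T * gcoeff (e (r T)) (insert (r T) T))"
  have r: "r T \<notin> T" if "T \<noteq> UNIV" for T
    unfolding r_def by (rule someI_ex) (use that in auto)
  have c: "gcoeff c T = s i T * gcoeff (e i) (insert i T)" if "i \<notin> T" for i T
  proof -
    have "T \<noteq> UNIV" using that by auto
    then show ?thesis using key [OF that r] by (simp add: c_def)
  qed
  show thesis
  proof
    show "c \<in> odd_part"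
      unfolding graded_part_iff
    proof (intro allI impI)
      fix T assume cT: "gcoeff c T \<noteq> 0"
      then have "T \<noteq> UNIV" by (auto simp: c_def)
      note rT = r [OF this]
      from cT have "gcoeff (e (r T)) (insert (r T) T) \<noteq> 0" by (auto simp: c [OF rT])
      with even have "even (card (insert (r T) T))" by (auto simp: graded_part_iff)
      with rT show "card T \<in> {d. odd d}" by simp
    qed
    fix i
    show "e i = gen i * c"
    proof (rule grassmann_eqI)
      fix S
      show "gcoeff (e i) S = gcoeff (gen i * c) S"
      proof (cases "i \<in> S")
        case True
        then have "gcoeff (gen i * c) S = (s i (S - {i}) * s i (S - {i})) * gcoeff (e i) S"
          by (simp add: gcoeff_gen_mult c [of i] s_def [symmetric] insert_absorb mult.assoc)
        then show ?thesis by (simp add: s_square)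
      next
        case False
        \<comment> \<open>By \<open>sq\<close>, only monomials containing \<open>i\<close> can occur
          in \<open>e i\<close>, matching the right side, which vanishes at
          \<open>S\<close>.\<close>
        have "gcoeff (gen i * e i) (insert i S) = 0" by (simp add: sq)
        with False have "s i S * gcoeff (e i) S = 0" by (simp add: gcoeff_gen_mult s_def)
        then have "s i S * s i S * gcoeff (e i) S = 0" by (simp only: mult.assoc) simp
        with False show ?thesis by (simp add: s_square gcoeff_gen_mult)
      qed
    qed
  qed
qed

text \<open>The even parts \<open>p i\<close> are pulled back along \<open>\<gamma>\<close>. This
  turns the relation between the \<open>p i\<close> and \<open>q i\<close> into one between the
  elements \<open>e i\<close> and the generators themselves, so that
  \<open>common_right_quotient_by_gens\<close> applies.\<close>

lemma grassmann_U_decomp: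
  fixes \<sigma> :: "('k::comm_ring_1, 'n::{finite,linorder}) gmap"
  assumes half: "\<exists>h::'k. 2 * h = 1" and \<sigma>: "\<sigma> \<in> grassmann_U"
  obtains a \<gamma> where "a \<in> odd_part" "\<gamma> \<in> grassmann_Gamma" "\<sigma> = omega a \<circ> \<gamma>"
proof -
  have hom\<sigma>: "alg_hom gscale gscale \<sigma>" and uni: "\<And>i. \<sigma> (gen i) - gen i \<in> graded_part {2..}"
    using \<sigma> by (auto simp: grassmann_U_iff carrier_grassmann_Aut)
  define p where "p i = even_proj (\<sigma> (gen i))" for i
  define q where "q i = odd_proj (\<sigma> (gen i))" for i
  have pq: "\<sigma> (gen i) = p i + q i" for i by (simp add: p_def q_def even_odd_decomp)
  have p: "p i \<in> graded_part {d. even d}" and q: "q i \<in> odd_part" for i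
    by (simp_all add: p_def q_def)
  define \<gamma> where "\<gamma> = subst_hom gscale q"
  have hom\<gamma>: "alg_hom gscale gscale \<gamma>"
    unfolding \<gamma>_def by (rule alg_hom_odd_subst [OF half q])
  have \<gamma>_gen: "\<gamma> (gen i) = q i" for i by (simp add: \<gamma>_def grassmann.subst_hom_gen)
  have uni\<gamma>: "\<gamma> (gen i) - gen i \<in> graded_part {2..}" for i
  proof -
    have "\<gamma> (gen i) - gen i = odd_proj (\<sigma> (gen i) - gen i)"
      unfolding \<gamma>_gen q_def by (rule grassmann_eqI) (auto simp: gcoeff_gen)
    with uni [of i] show ?thesis by (auto simp: graded_part_iff)
  qed
  have \<gamma>: "\<gamma> \<in> grassmann_Gamma"
    using unipotent_bij [OF hom\<gamma> uni\<gamma>] hom\<gamma> uni\<gamma> q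
    by (simp add: grassmann_Gamma_iff grassmann_U_iff carrier_grassmann_Aut \<gamma>_gen)
  have rel: "p i * q j = - (p j * q i)" for i j
  proof -
    have "\<sigma> (gen i) * \<sigma> (gen j) + \<sigma> (gen j) * \<sigma> (gen i) = \<sigma> (gen i * gen j + gen j * gen i)"
      by (simp add: alg_homD [OF hom\<sigma>])
    also have "gen i * gen j + gen j * gen i = (0 :: ('k, 'n) grassmann)"
      by (cases "i = j") (simp_all add: gen_square gen_anticommute [of i j])
    finally have "odd_proj ((p i + q i) * (p j + q j) + (p j + q j) * (p i + q i)) = 0"
      by (simp add: pq alg_homD [OF hom\<sigma>] gproj_zero)
    \<comment> \<open>The products of two odd parts cancel and even parts commute with everything,
      so the odd component is twice \<open>p i * q j + p j * q i\<close>.\<close>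
    moreover have "(p i + q i) * (p j + q j) + (p j + q j) * (p i + q i) =
        (p i * p j + p j * p i) + ((p i * q j + p j * q i) + (p i * q j + p j * q i))"
      using even_mult_commute [OF p, of "q i" j] even_mult_commute [OF p, of "q j" i]
        odd_mult_anticommute [OF q q, of i j]
      by (simp add: algebra_simps)
    moreover have "odd_proj (p i * p j + p j * p i) = 0"
      by (rule gproj_eq_0 [where E = "{d. even d}"])
        (auto intro!: graded_part_add graded_part_mult [OF p p])
    moreover have "p i * q j + p j * q i \<in> odd_part"
      by (auto intro!: graded_part_add graded_part_mult [OF p q])
    ultimately have "(p i * q j + p j * q i) + (p i * q j + p j * q i) = 0"
      by (simp add: gproj_add [of _ "p i * p j + p j * p i"] gproj_eq_self graded_part_add)
    from double_eq_0 [OF half this] show ?thesis by (simp add: eq_neg_iff_add_eq_0)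
  qed
  have \<gamma>_bij: "bij \<gamma>" using unipotent_bij [OF hom\<gamma> uni\<gamma>] .
  define e where "e i = inv_into UNIV \<gamma> (p i)" for i
  have \<gamma>_e: "\<gamma> (e i) = p i" for i
    using \<gamma>_bij by (simp add: e_def bij_is_surj surj_f_inv_f)
  have e: "e i \<in> graded_part {d. even d}" for i
    using p [of i] grassmann_Gamma_even_iff [OF \<gamma>, of "e i"] by (simp add: \<gamma>_e)
  have anti: "gen i * e j = - (gen j * e i)" for i j
  proof -
    have "\<gamma> (gen i * e j) = \<gamma> (- (gen j * e i))"
      using rel [of i j] even_mult_commute [OF p, of "q i" j] even_mult_commute [OF p, of "q j" i]
      by (simp add: alg_homD [OF hom\<gamma>] \<gamma>_gen \<gamma>_e)
    then show ?thesis using \<gamma>_bij by (simp add: bij_is_inj inj_eq)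
  qed
  \<comment> \<open>The diagonal case of \<open>anti\<close> says that the product equals its own
    negative.\<close>
  have "gen i * e i = 0" for i
    by (rule double_eq_0 [OF half]) (use anti [of i i] in \<open>simp add: eq_neg_iff_add_eq_0\<close>)
  then obtain c where c: "c \<in> odd_part" "\<And>i. e i = gen i * c"
    using common_right_quotient_by_gens [OF anti _ e] by metis
  obtain h :: 'k where h: "2 * h = 1" using half by blast
  \<comment> \<open>Applying \<open>\<gamma>\<close> to \<open>e i = gen i * c\<close> gives
    \<open>p i = q i * \<gamma> c = - (\<gamma> c * q i)\<close>; equating this with twice
    \<open>a * q i\<close> dictates the factor \<open>- h\<close>.\<close>
  define a where "a = gscale (- h) (\<gamma> c)"
  have "\<gamma> c \<in> odd_part" using c(1) by (simp add: grassmann_Gamma_odd_iff [OF \<gamma>])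
  then have a: "a \<in> odd_part" unfolding a_def by (rule graded_part_scale)
  have a_q: "a * q i + a * q i = p i" for i
  proof -
    have "p i = q i * \<gamma> c" using \<gamma>_e [of i] by (simp add: c(2) alg_homD [OF hom\<gamma>] \<gamma>_gen)
    also have "\<dots> = - (\<gamma> c * q i)" by (rule odd_mult_anticommute [OF \<open>\<gamma> c \<in> odd_part\<close> q])
    also have "\<dots> = gscale (- h + - h) (\<gamma> c * q i)"
      using h by (simp flip: mult_2)
    also have "\<dots> = a * q i + a * q i"
      by (simp only: a_def grassmann.scale_mult_left grassmann.scale_left_distrib distrib_right)
    finally show ?thesis by simp
  qed
  have "\<sigma> = omega a \<circ> \<gamma>"
  proof (rule alg_hom_eqI [OF hom\<sigma>])
    show "alg_hom gscale gscale (omega a \<circ> \<gamma>)"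
      using omega_in_U [OF half a] hom\<gamma>
      by (intro alg_hom_comp) (auto simp: grassmann_U_iff carrier_grassmann_Aut)
    fix i
    have "omega a (q i) = q i + (a * q i + a * q i)"
      unfolding omega_def gproj_eq_self [OF q] ..
    then show "\<sigma> (gen i) = (omega a \<circ> \<gamma>) (gen i)"
      unfolding a_q by (simp add: \<gamma>_gen pq add.commute)
  qed
  with a \<gamma> that show thesis by blast
qed

subsection \<open>The semidirect products\<close>

text \<open>By \<open>omega_comp\<close>, \<open>omega\<close> carries addition of odd elements to
  composition, so sums and negatives of odd elements give the closure properties.\<close>

lemma subgroup_grassmann_Omega:
  assumes half: "\<exists>h::'k::comm_ring_1. 2 * h = 1"
  shows "subgroup (grassmann_Omega :: ('k, 'n::{finite,linorder}) gmap set) grassmann_Aut"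
proof -
  interpret group "grassmann_Aut :: ('k, 'n) gmap monoid" by (rule group_grassmann_Aut)
  note eq = grassmann_Omega_eq [OF half]
  have carrier: "omega a \<in> carrier grassmann_Aut" if "a \<in> odd_part" for a :: "('k, 'n) grassmann"
    using omega_in_U [OF half that] by (simp add: grassmann_U_iff)
  show ?thesis
  proof (rule subgroupI)
    show "(grassmann_Omega :: ('k, 'n) gmap set) \<subseteq> carrier grassmann_Aut"
      using carrier by (auto simp: eq)
    show "(grassmann_Omega :: ('k, 'n) gmap set) \<noteq> {}"
      unfolding eq using graded_part_zero by blast
  next
    fix x :: "('k, 'n) gmap" assume "x \<in> grassmann_Omega"
    then obtain a where a: "a \<in> odd_part" "x = omega a" by (auto simp: eq)
    have "inv\<^bsub>grassmann_Aut\<^esub> x = omega (- a)"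
      using omega_comp [OF a(1), of "- a"] a carrier graded_part_uminus
      by (intro inv_equality) (auto simp: omega_0)
    then show "inv\<^bsub>grassmann_Aut\<^esub> x \<in> grassmann_Omega"
      using graded_part_uminus [OF a(1)] by (auto simp: eq)
  next
    fix x y :: "('k, 'n) gmap" assume "x \<in> grassmann_Omega" "y \<in> grassmann_Omega"
    then obtain a b where "a \<in> odd_part" "x = omega a" "b \<in> odd_part" "y = omega b"
      by (auto simp: eq)
    then show "x \<otimes>\<^bsub>grassmann_Aut\<^esub> y \<in> grassmann_Omega"
      by (auto simp: eq omega_comp intro: graded_part_add)
  qed
qed

lemma normal_grassmann_U:
  assumes reduced: "\<forall>(c::'k::comm_ring_1) m. c ^ m = 0 \<longrightarrow> c = 0"
  shows "(grassmann_U :: ('k, 'n::{finite,linorder}) gmap set) \<lhd> grassmann_Aut"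
proof -
  interpret group "grassmann_Aut :: ('k, 'n) gmap monoid" by (rule group_grassmann_Aut)
  note U_iff = grassmann_U_iff_linear_part [OF reduced]
  have comp: "linear_part (\<sigma> \<circ> \<tau>) = linear_part \<tau> ** linear_part \<sigma>"
    if "\<sigma> \<in> carrier grassmann_Aut" for \<sigma> \<tau> :: "('k, 'n) gmap"
    using that grassmann_Aut_gen_in_aug_ideal [OF reduced]
    by (intro linear_part_comp) (auto simp: carrier_grassmann_Aut)
  have closed: "x \<circ> y \<in> carrier grassmann_Aut"
    if "x \<in> carrier grassmann_Aut" "y \<in> carrier grassmann_Aut" for x y :: "('k, 'n) gmap"
    using m_closed [OF that] by simp
  have r_inv': "x \<circ> inv\<^bsub>grassmann_Aut\<^esub> x = id"
    if "x \<in> carrier grassmann_Aut" for x :: "('k, 'n) gmap"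
    using r_inv [OF that] by simp
  show ?thesis
    unfolding normal_inv_iff
  proof (intro conjI ballI)
    show "subgroup (grassmann_U :: ('k, 'n) gmap set) grassmann_Aut"
    proof (rule subgroupI)
      show "(grassmann_U :: ('k, 'n) gmap set) \<subseteq> carrier grassmann_Aut" by (auto simp: U_iff)
      have "id \<in> (grassmann_U :: ('k, 'n) gmap set)"
        using one_closed by (simp add: U_iff linear_part_id)
      then show "(grassmann_U :: ('k, 'n) gmap set) \<noteq> {}" by blast
    next
      fix x :: "('k, 'n) gmap" assume "x \<in> grassmann_U"
      then have x: "x \<in> carrier grassmann_Aut" "linear_part x = mat 1" by (auto simp: U_iff)
      \<comment> \<open>Composing with \<open>x\<close> only multiplies the matrix of the inverse by
        \<open>mat 1\<close>.\<close>
      have "linear_part (inv\<^bsub>grassmann_Aut\<^esub> x) = linear_part (x \<circ> inv\<^bsub>grassmann_Aut\<^esub> x)"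
        by (simp add: comp x)
      then show "inv\<^bsub>grassmann_Aut\<^esub> x \<in> grassmann_U"
        by (simp add: U_iff r_inv' x linear_part_id)
    next
      fix x y :: "('k, 'n) gmap" assume "x \<in> grassmann_U" "y \<in> grassmann_U"
      then show "x \<otimes>\<^bsub>grassmann_Aut\<^esub> y \<in> grassmann_U"
        by (simp add: U_iff comp closed)
    qed
    fix x h :: "('k, 'n) gmap" assume x: "x \<in> carrier grassmann_Aut" and "h \<in> grassmann_U"
    then have h: "h \<in> carrier grassmann_Aut" "linear_part h = mat 1" by (auto simp: U_iff)
    have "linear_part (x \<circ> h \<circ> inv\<^bsub>grassmann_Aut\<^esub> x) = linear_part (x \<circ> inv\<^bsub>grassmann_Aut\<^esub> x)"
      by (simp add: comp closed x h)
    then show "x \<otimes>\<^bsub>grassmann_Aut\<^esub> h \<otimes>\<^bsub>grassmann_Aut\<^esub> inv\<^bsub>grassmann_Aut\<^esub> x \<in> grassmann_U"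
      by (simp add: U_iff closed x h r_inv' linear_part_id)
  qed
qed

text \<open>Inside \<open>grassmann_U\<close> only oddness of the images of generators must be
  checked; for inverses this is the converse half of the parity criterion.\<close>

lemma subgroup_grassmann_Gamma:
  assumes U: "subgroup (grassmann_U :: ('k::comm_ring_1, 'n::{finite,linorder}) gmap set) grassmann_Aut"
  shows "subgroup (grassmann_Gamma :: ('k, 'n) gmap set) grassmann_Aut"
proof -
  interpret group "grassmann_Aut :: ('k, 'n) gmap monoid" by (rule group_grassmann_Aut)
  show ?thesis
  proof (rule subgroupI)
    show "(grassmann_Gamma :: ('k, 'n) gmap set) \<subseteq> carrier grassmann_Aut"
      by (auto simp: grassmann_Gamma_def)
    have "id \<in> (grassmann_Gamma :: ('k, 'n) gmap set)"
      using subgroup.one_closed [OF U] by (simp add: grassmann_Gamma_iff gen_in_graded_part)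
    then show "(grassmann_Gamma :: ('k, 'n) gmap set) \<noteq> {}" by blast
  next
    fix x :: "('k, 'n) gmap" assume x: "x \<in> grassmann_Gamma"
    then have xU: "x \<in> grassmann_U" and xc: "x \<in> carrier grassmann_Aut"
      by (auto simp: grassmann_Gamma_iff grassmann_U_iff)
    have "(inv\<^bsub>grassmann_Aut\<^esub> x) (gen i) \<in> odd_part" for i
      using grassmann_Gamma_odd_iff [OF x, of "(inv\<^bsub>grassmann_Aut\<^esub> x) (gen i)"]
      by (simp add: inv_grassmann_Aut [OF xc] gen_in_graded_part)
    then show "inv\<^bsub>grassmann_Aut\<^esub> x \<in> grassmann_Gamma"
      using subgroup.m_inv_closed [OF U xU] by (simp add: grassmann_Gamma_iff)
  next
    fix x y :: "('k, 'n) gmap" assume x: "x \<in> grassmann_Gamma" and y: "y \<in> grassmann_Gamma"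
    from x y have "x \<in> grassmann_U" "y \<in> grassmann_U" by (auto simp: grassmann_Gamma_iff)
    from subgroup.m_closed [OF U this] y show "x \<otimes>\<^bsub>grassmann_Aut\<^esub> y \<in> grassmann_Gamma"
      by (simp add: grassmann_Gamma_iff grassmann_Gamma_odd_iff [OF x])
  qed
qed

lemma grassmann_Omega_set_mult_Gamma:
  assumes half: "\<exists>h::'k::comm_ring_1. 2 * h = 1"
    and U: "subgroup (grassmann_U :: ('k, 'n::{finite,linorder}) gmap set) grassmann_Aut"
  shows "grassmann_Omega <#>\<^bsub>grassmann_Aut\<^esub> grassmann_Gamma = (grassmann_U :: ('k, 'n) gmap set)"
proof
  show "grassmann_Omega <#>\<^bsub>grassmann_Aut\<^esub> grassmann_Gamma \<subseteq> (grassmann_U :: ('k, 'n) gmap set)"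
  proof
    fix x :: "('k, 'n) gmap" assume "x \<in> grassmann_Omega <#>\<^bsub>grassmann_Aut\<^esub> grassmann_Gamma"
    then obtain a \<gamma> where "a \<in> odd_part" "\<gamma> \<in> grassmann_Gamma" "x = omega a \<circ> \<gamma>"
      by (auto simp: set_mult_def grassmann_Omega_eq [OF half])
    moreover from this have "omega a \<in> grassmann_U" "\<gamma> \<in> grassmann_U"
      using omega_in_U [OF half] by (auto simp: grassmann_Gamma_iff)
    ultimately show "x \<in> grassmann_U" using subgroup.m_closed [OF U, of "omega a" \<gamma>] by simp
  qed
  show "(grassmann_U :: ('k, 'n) gmap set) \<subseteq> grassmann_Omega <#>\<^bsub>grassmann_Aut\<^esub> grassmann_Gamma"
  proof
    fix x :: "('k, 'n) gmap" assume "x \<in> grassmann_U"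
    then obtain a \<gamma> where "a \<in> odd_part" "\<gamma> \<in> grassmann_Gamma" "x = omega a \<circ> \<gamma>"
      by (rule grassmann_U_decomp [OF half])
    then show "x \<in> grassmann_Omega <#>\<^bsub>grassmann_Aut\<^esub> grassmann_Gamma"
      by (auto simp: set_mult_def grassmann_Omega_eq [OF half])
  qed
qed

text \<open>\<open>omega a\<close> changes a generator by an even element, whereas
  \<open>grassmann_Gamma\<close> requires an odd image; comparing odd projections shows that the
  generator is fixed.\<close>

lemma grassmann_Omega_Int_Gamma:
  assumes half: "\<exists>h::'k::comm_ring_1. 2 * h = 1"
    and U: "subgroup (grassmann_U :: ('k, 'n::{finite,linorder}) gmap set) grassmann_Aut"
  shows "grassmann_Omega \<inter> grassmann_Gamma = {id :: ('k, 'n) gmap}"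
proof -
  have "x = id" if xO: "x \<in> grassmann_Omega" and xG: "x \<in> grassmann_Gamma" for x :: "('k, 'n) gmap"
  proof -
    obtain a where a: "a \<in> odd_part" "x = omega a"
      using xO by (auto simp: grassmann_Omega_eq [OF half])
    have hom: "alg_hom gscale gscale x"
      using omega_in_U [OF half a(1)] by (simp add: a grassmann_U_iff carrier_grassmann_Aut)
    show "x = id"
    proof (rule alg_hom_eqI [OF hom])
      have "id \<in> (grassmann_U :: ('k, 'n) gmap set)" using subgroup.one_closed [OF U] by simp
      then show "alg_hom gscale gscale (id :: ('k, 'n) gmap)"
        by (simp add: grassmann_U_iff carrier_grassmann_Aut)
      fix i :: 'n
      define g where "g = (gen i :: ('k, 'n) grassmann)"
      have g: "g \<in> odd_part" by (simp add: g_def gen_in_graded_part)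
      have "a * g \<in> graded_part {d. even d}"
        by (rule graded_part_mult [OF a(1) g]) auto
      then have "odd_proj (omega a g) = odd_proj g"
        unfolding omega_def by (simp add: gproj_add gproj_eq_self [OF g] gproj_eq_0 [where E = "{d. even d}"] disjoint_iff)
      moreover have "odd_proj (x g) = x g"
        using xG by (intro gproj_eq_self) (simp add: g_def grassmann_Gamma_iff)
      ultimately show "x (gen i) = id (gen i)"
        by (simp add: a(2) gproj_eq_self [OF g] flip: g_def)
    qed
  qed
  moreover have "id \<in> (grassmann_Omega :: ('k, 'n) gmap set)" "id \<in> (grassmann_Gamma :: ('k, 'n) gmap set)"
    using subgroup.one_closed [OF subgroup_grassmann_Omega [OF half]]
      subgroup.one_closed [OF subgroup_grassmann_Gamma [OF U]] by simp_all
  ultimately show ?thesis by blast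
qed

text \<open>The subgroup property of \<open>grassmann_U\<close> is assumed here;
  \<open>normal_grassmann_U\<close> supplies it.\<close>

lemma semidirect_Omega_Gamma:
  assumes half: "\<exists>h::'k::comm_ring_1. 2 * h = 1"
    and U: "subgroup (grassmann_U :: ('k, 'n::{finite,linorder}) gmap set) grassmann_Aut"
  shows "semidirect ((grassmann_Aut :: ('k, 'n) gmap monoid)\<lparr>carrier := grassmann_U\<rparr>)
    grassmann_Omega grassmann_Gamma"
proof -
  let ?G = "grassmann_Aut :: ('k, 'n) gmap monoid"
  let ?H = "?G\<lparr>carrier := grassmann_U\<rparr>"
  interpret group ?G by (rule group_grassmann_Aut)
  interpret H: group ?H by (rule subgroup_imp_group [OF U])
  note \<Omega> = subgroup_grassmann_Omega [OF half] and \<Gamma> = subgroup_grassmann_Gamma [OF U]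
  have "grassmann_Omega \<subseteq> (grassmann_U :: ('k, 'n) gmap set)"
    using omega_in_U [OF half] by (auto simp: grassmann_Omega_eq [OF half])
  from subgroup_incl [OF \<Omega> U this] have \<Omega>H: "subgroup grassmann_Omega ?H" .
  have "grassmann_Gamma \<subseteq> (grassmann_U :: ('k, 'n) gmap set)"
    by (auto simp: grassmann_Gamma_iff)
  from subgroup_incl [OF \<Gamma> U this] have \<Gamma>H: "subgroup grassmann_Gamma ?H" .
  have conj: "x \<circ> h \<circ> inv\<^bsub>?G\<^esub> x \<in> grassmann_Omega"
    if x: "x \<in> grassmann_U" and h: "h \<in> grassmann_Omega" for x h :: "('k, 'n) gmap"
  proof -
    obtain a \<gamma> where a: "a \<in> odd_part" and \<gamma>: "\<gamma> \<in> grassmann_Gamma" and x_eq: "x = omega a \<circ> \<gamma>"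
      using x by (rule grassmann_U_decomp [OF half])
    obtain b where b: "b \<in> odd_part" "h = omega b"
      using h by (auto simp: grassmann_Omega_eq [OF half])
    have \<gamma>b: "\<gamma> b \<in> odd_part" using b by (simp add: grassmann_Gamma_odd_iff [OF \<gamma>])
    have xc: "x \<in> carrier ?G" using x by (simp add: grassmann_U_iff)
    have "x \<circ> h \<circ> inv\<^bsub>?G\<^esub> x = omega a \<circ> (\<gamma> \<circ> omega b) \<circ> inv\<^bsub>?G\<^esub> x"
      by (simp only: x_eq b comp_assoc)
    also have "\<dots> = (omega a \<circ> omega (\<gamma> b)) \<circ> \<gamma> \<circ> inv\<^bsub>?G\<^esub> x"
      by (simp only: grassmann_Gamma_comp_omega [OF \<gamma>] comp_assoc)
    \<comment> \<open>Commuting the two factors puts \<open>omega a\<close> back next to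
      \<open>\<gamma>\<close>, which restores \<open>x\<close> and lets it cancel against its
      inverse.\<close>
    also have "omega a \<circ> omega (\<gamma> b) = omega (\<gamma> b) \<circ> omega a"
      by (simp add: omega_comp [OF \<gamma>b] omega_comp [OF a] add.commute)
    also have "(omega (\<gamma> b) \<circ> omega a) \<circ> \<gamma> \<circ> inv\<^bsub>?G\<^esub> x = omega (\<gamma> b) \<circ> (x \<circ> inv\<^bsub>?G\<^esub> x)"
      by (simp only: x_eq comp_assoc)
    also have "x \<circ> inv\<^bsub>?G\<^esub> x = id" using r_inv [OF xc] by simp
    finally have "x \<circ> h \<circ> inv\<^bsub>?G\<^esub> x = omega (\<gamma> b)" by (simp only: comp_id)
    with \<gamma>b show ?thesis by (simp only: grassmann_Omega_eq [OF half] image_eqI)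
  qed
  have "grassmann_Omega \<lhd> ?H"
    unfolding H.normal_inv_iff using \<Omega>H conj by (auto simp: m_inv_consistent [OF U])
  moreover have "grassmann_Omega <#>\<^bsub>?H\<^esub> grassmann_Gamma = carrier ?H"
    using grassmann_Omega_set_mult_Gamma [OF half U] by (simp add: set_mult_def)
  ultimately show ?thesis
    unfolding semidirect_def using \<Gamma>H grassmann_Omega_Int_Gamma [OF half U] by simp
qed

lemma semidirect_U_GL:
  assumes reduced: "\<forall>(c::'k::comm_ring_1) m. c ^ m = 0 \<longrightarrow> c = 0"
    and half: "\<exists>h::'k. 2 * h = 1"
  shows "semidirect (grassmann_Aut :: ('k, 'n::{finite,linorder}) gmap monoid) grassmann_U grassmann_GL"
proof -
  let ?G = "grassmann_Aut :: ('k, 'n) gmap monoid"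
  interpret group ?G by (rule group_grassmann_Aut)
  note U_iff = grassmann_U_iff_linear_part [OF reduced] and comp = linear_subst_comp [OF half]
    and mat_1 = linear_subst_mat_1 [OF half]
  have carrier: "linear_subst A \<in> carrier ?G" if "A ** B = mat 1" "B ** A = mat 1" for A B
  proof -
    have "bij (linear_subst A :: ('k, 'n) gmap)"
      by (rule o_bij [of "linear_subst B"]) (simp_all add: comp that mat_1)
    then show ?thesis by (simp add: carrier_grassmann_Aut alg_hom_linear_subst [OF half])
  qed
  have inv: "inv\<^bsub>?G\<^esub> (linear_subst A) = linear_subst B" if "A ** B = mat 1" "B ** A = mat 1" for A B
    by (rule inv_equality) (simp_all add: comp mat_1 carrier [OF that] carrier [OF that(2,1)] that)
  have sub: "subgroup (grassmann_GL :: ('k, 'n) gmap set) ?G"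
  proof (rule subgroupI)
    show "grassmann_GL \<subseteq> carrier ?G"
      unfolding grassmann_GL_def invertible_def using carrier by auto
    have "invertible (mat 1 :: 'k ^ 'n::{finite,linorder} ^ 'n::{finite,linorder})"
      unfolding invertible_def by (auto intro: exI [of _ "mat 1"])
    then show "(grassmann_GL :: ('k, 'n) gmap set) \<noteq> {}" by (auto simp: grassmann_GL_def)
  next
    fix x :: "('k, 'n) gmap" assume "x \<in> grassmann_GL"
    then obtain A B where AB: "A ** B = mat 1" "B ** A = mat 1" "x = linear_subst A"
      unfolding grassmann_GL_def invertible_def by auto
    then show "inv\<^bsub>?G\<^esub> x \<in> grassmann_GL"
      unfolding grassmann_GL_def invertible_def using inv [OF AB(1,2)] by auto
  next
    fix x y :: "('k, 'n) gmap" assume "x \<in> grassmann_GL" "y \<in> grassmann_GL"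
    then show "x \<otimes>\<^bsub>?G\<^esub> y \<in> grassmann_GL"
      unfolding grassmann_GL_def by (auto simp: comp intro: invertible_mult)
  qed
  have int: "grassmann_U \<inter> grassmann_GL = {id :: ('k, 'n) gmap}"
  proof -
    have "x = id" if "x \<in> grassmann_U" "x \<in> grassmann_GL" for x :: "('k, 'n) gmap"
      using that by (auto simp: grassmann_GL_def U_iff linear_part_linear_subst mat_1)
    moreover have "id \<in> (grassmann_U :: ('k, 'n) gmap set)" "id \<in> (grassmann_GL :: ('k, 'n) gmap set)"
      using subgroup.one_closed [OF sub] one_closed by (simp_all add: U_iff linear_part_id)
    ultimately show ?thesis by blast
  qed
  have "x \<in> grassmann_U <#>\<^bsub>?G\<^esub> grassmann_GL" if x: "x \<in> carrier ?G" for x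
  proof -
    let ?y = "inv\<^bsub>?G\<^esub> x"
    have lin: "linear_part (\<sigma> \<circ> \<tau>) = linear_part \<tau> ** linear_part \<sigma>"
      if "\<sigma> \<in> carrier ?G" for \<sigma> \<tau> :: "('k, 'n) gmap"
      using that grassmann_Aut_gen_in_aug_ideal [OF reduced]
      by (intro linear_part_comp) (auto simp: carrier_grassmann_Aut)
    have xy: "x \<circ> ?y = id" "?y \<circ> x = id" using r_inv [OF x] l_inv [OF x] by simp_all
    \<comment> \<open>Taking linear parts of both composites shows that the matrix of
      \<open>x\<close> is invertible, with the matrix of \<open>?y\<close> as inverse.\<close>
    have AB: "linear_part ?y ** linear_part x = mat 1" "linear_part x ** linear_part ?y = mat 1"
      using lin [OF x, of ?y] lin [of ?y x] x by (simp_all add: xy linear_part_id)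
    \<comment> \<open>\<open>s\<close> is the linear substitution with the same linear part as
      \<open>x\<close>, and \<open>t\<close> undoes it. Thus \<open>x \<circ> t\<close> has trivial
      linear part, and composing with \<open>s\<close> recovers \<open>x\<close>.\<close>
    define s where "s = (linear_subst (linear_part x) :: ('k, 'n) gmap)"
    define t where "t = (linear_subst (linear_part ?y) :: ('k, 'n) gmap)"
    have st: "t \<circ> s = id" by (simp add: s_def t_def comp AB mat_1)
    have t: "t \<in> carrier ?G" unfolding t_def by (rule carrier [OF AB])
    have "x \<circ> t \<in> carrier ?G" using m_closed [OF x t] by simp
    moreover have "linear_part (x \<circ> t) = mat 1"
      by (simp add: lin [OF x] t_def linear_part_linear_subst AB)
    ultimately have "x \<circ> t \<in> grassmann_U" by (simp add: U_iff)
    moreover have "s \<in> grassmann_GL"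
      unfolding grassmann_GL_def invertible_def s_def using AB by blast
    moreover have "x = (x \<circ> t) \<otimes>\<^bsub>?G\<^esub> s" by (simp add: comp_assoc st)
    ultimately show ?thesis unfolding set_mult_def by blast
  qed
  moreover have "grassmann_U <#>\<^bsub>?G\<^esub> grassmann_GL \<subseteq> carrier ?G"
    using subgroup.subset [OF sub] by (intro setmult_subset_G) (auto simp: grassmann_U_iff)
  ultimately show ?thesis
    unfolding semidirect_def using normal_grassmann_U [OF reduced] sub int by auto
qed

theorem theorem2p14:
  fixes G :: "('k::comm_ring_1, 'n::{finite,linorder}) gmap monoid"
    and U \<Omega> \<Gamma> GL :: "('k, 'n) gmap set"
  defines "G \<equiv> grassmann_Aut"
    and "U \<equiv> grassmann_U"
    and "\<Omega> \<equiv> grassmann_Omega"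
    and "\<Gamma> \<equiv> grassmann_Gamma"
    and "GL \<equiv> grassmann_GL"
  assumes reduced: "\<forall>(c::'k) m. c ^ m = 0 \<longrightarrow> c = 0"
    and half: "\<exists>h::'k. 2 * h = 1"
  shows "semidirect (G\<lparr>carrier := U\<rparr>) \<Omega> \<Gamma>
    \<and> semidirect G U GL
    \<and> semidirect (G\<lparr>carrier := \<Omega> <#>\<^bsub>G\<^esub> \<Gamma>\<rparr>) \<Omega> \<Gamma>
    \<and> semidirect G (\<Omega> <#>\<^bsub>G\<^esub> \<Gamma>) GL"
proof -
  have U: "subgroup (grassmann_U :: ('k, 'n) gmap set) grassmann_Aut"
    by (rule normal_imp_subgroup [OF normal_grassmann_U [OF reduced]])
  show ?thesis
    \<comment> \<open>Rewriting the product of \<open>\<Omega>\<close> and \<open>\<Gamma>\<close>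
      to \<open>grassmann_U\<close> turns the last two conjuncts into the first two.\<close>
    unfolding G_def U_def \<Omega>_def \<Gamma>_def GL_def grassmann_Omega_set_mult_Gamma [OF half U]
    using semidirect_Omega_Gamma [OF half U] semidirect_U_GL [OF reduced half] by blast
qed

end
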